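(* Fix $q\in(2,3]$, let $f,g$ satisfy Assumption (A1), and let $\{x^k\},\{y^k\}$ be generated by Algorithm (Alg) such that Assumption (A2) holds; let $\Gamma,L_g,L_H,\widehat{L}$ be as in the context. Fix $\overline{x}\in\omega(x^0)$. Suppose the algorithm parameter $\varrho$ satisfies $0<\varrho<\frac{1-\varsigma}{1+\varsigma+L_g}$ for some $\varsigma\in(0,1)$, and that there exist $\widehat{\varepsilon}>0$, $\kappa>0$ and $\gamma\in(\frac{1}{q-1},1]$ such that $\mathrm{dist}(x,\mathcal{X}^* )\le\kappa[r(x)]^\gamma$ for all $x\in\mathbb{B}(\overline{x},\widehat{\varepsilon})$. Put $$\eta_0:=1-\varsigma-\varrho(1+\varsigma+L_g),\qquad \eta:=\frac{2+L_HL_m^{-1}}{2\eta_0}+\frac{\sqrt{2L_H(\eta_0L_m)^{-1}+\eta_0^{-2}(2+L_HL_m^{-1})^2}}{2},$$ $$\widehat{c}:=\big[(3+L_g)\varrho\widehat{L}+L_H/2+\widehat{L}\big]\eta^{q-1}.$$ Then for all $k$ large enough, $$r(x^{k+1})\le\kappa^{q-1}\widehat{c}\,[r(x^k)]^{\gamma(q-1)}\quad\text{and}\quad \|x^{k+1}-\overline{x}\|\le2\eta\kappa(1+\varsigma)\widehat{c}^{\,\gamma}\|x^k-\overline{x}\|^{\gamma(q-1)};$$ that is, $\{r(x^k)\}$ and $\{x^k\}$ converge to $0$ and to $\overline{x}\in\mathcal{X}^*$, respectively, with $Q$-superlinear rate of order $\gamma(q-1)$.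
   Context: $\mathbb{X}$ is a finite-dimensional real vector space with inner product $\langle\cdot,\cdot\rangle$ and induced norm $\|\cdot\|$; $\overline{\mathbb{R}}=(-\infty,\infty]$; $f,g:\mathbb{X}\to\overline{\mathbb{R}}$, $F:=f+g$; $\mathbb{B}(x,\delta)$ is the closed ball. Assumption (A1): $f$ is proper lower semicontinuous (lsc) and twice continuously differentiable on an open set $\mathcal{O}\supset\mathrm{cl}(\mathrm{dom}\,g)$; $g$ is proper, lsc, convex with $\mathrm{dom}\,g\neq\emptyset$; $F$ is bounded below. $\partial$ denotes the limiting (Mordukhovich) subdifferential. $\mathcal{S}^*:=\{x: 0\in\partial F(x)\}$. $\mathrm{prox}_g(x):=\arg\min_z\{\frac12\|z-x\|^2+g(z)\}$. The residual function is $r(x):=\|x-\mathrm{prox}_g(x-\nabla f(x))\|$. The set of second-order stationary points is $\mathcal{X}^*:=\{x\in\mathcal{S}^*:\langle\mathrm{prox}_g(z)-x,\nabla^2f(x)(\mathrm{prox}_g(z)-x)\rangle\ge0\ \ \forall z\in\mathbb{X}\}$. Algorithm (Alg). Input: $q\in[2,3]$, $0<L_m<L_M$, $\varrho\in(0,1)$, $\sigma\in(0,1)$, $\tau>1$, $x^0\in\mathrm{dom}\,g$. For $k=0,1,2,\dots$, with $\vartheta_k(x):=f(x^k)+\langle\nabla f(x^k),x-x^k\rangle+\frac12\langle\nabla^2f(x^k)(x-x^k),x-x^k\rangle$: 1. Choose $L_{k,0}\in[L_m,L_M]$, with in addition $L_{k,0}>\max(0,-\lambda_{\min}(\nabla^2f(x^k)))$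 if $q=2$. 2. For $j=0,1,2,\dots$: let $f_{k,j}(x):=\vartheta_k(x)+\frac{L_{k,j}}{q}\|x-x^k\|^q$, $\Theta_{k,j}:=f_{k,j}+g$, $R_{k,j}(x):=x-\mathrm{prox}_g(x-\nabla f_{k,j}(x))$, $r_{k,j}(x):=\|R_{k,j}(x)\|$. Compute $y^{k,j}$ with $r_{k,j}(y^{k,j})\le\varrho L_{k,j}\|y^{k,j}-x^k\|^{q-1}$ and $\Theta_{k,j}(y^{k,j})\le\Theta_{k,j}(x^k)$. If $F(y^{k,j})\le F(x^k)-\frac{\sigma L_{k,j}}{q}\|y^{k,j}-x^k\|^q$, set $j_k:=j$ and go to step 3; otherwise set $L_{k,j+1}:=\tau L_{k,j}$ and continue with $j+1$. 3. Set $L_k:=L_{k,j_k}$, $y^k:=y^{k,j_k}$, $v^k:=R_{k,j_k}(y^k)$, and $x^{k+1}:=y^k$ if $F(y^k)<F(y^k-v^k)$, $x^{k+1}:=y^k-v^k$ otherwise. $\omega(x^0)$ denotes the set of accumulation points of $\{x^k\}$. Assumption (A2): (i) $\{x^k\}_{k\in\mathbb{N}}$ is bounded; (ii) $\nabla^2f$ is strictly continuous (i.e. Lipschitz continuous on a neighborhood of each point) on an open convex set $\mathcal{N}$ with $\mathcal{O}\supset\mathcal{N}\supset\omega(x^0)$. Constants. Under (A1)–(A2) one has $\sup_kL_k<\infty$, $y^k-x^k\to0$, $v^k\to0$; $\widehat{L}>0$ denotes a constant with $L_k\le\widehat{L}$ for all $k$. Consequently one can fix a compact convex set $\Gamma\subset\mathcal{N}$,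 $\overline{\varepsilon}>0$ and $\overline{k}\in\mathbb{N}$ such that for all $k\ge\overline{k}$: $x^k\in\bigcup_{x\in\omega(x^0)}\mathbb{B}(x,\overline{\varepsilon}/2)\subset\bigcup_{x\in\omega(x^0)}\mathbb{B}(x,\overline{\varepsilon})\subset\Gamma$ and $y^k,\,y^k-v^k\in\Gamma$. $L_g>0$ and $L_H>0$ are Lipschitz constants on $\Gamma$ of $\nabla f$ and $\nabla^2f$, respectively. *)

theory Defs
  imports "HOL-Analysis.Analysis"
begin

text \<open>
  The space is an arbitrary type \<open>'a\<close> of class \<open>euclidean_space\<close>. Functions with values in
  \<open>(-\<infinity>, \<infinity>]\<close> are functions into \<open>ereal\<close>; the value \<open>-\<infinity>\<close> is excluded by \<open>proper\<close>.
\<close>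

section \<open>Extended-real-valued functions\<close>

definition edom :: "('a \<Rightarrow> ereal) \<Rightarrow> 'a set" where
  "edom h = {x. h x < \<infinity>}"

definition proper :: "('a \<Rightarrow> ereal) \<Rightarrow> bool" where
  "proper h \<longleftrightarrow> (\<forall>x. h x \<noteq> -\<infinity>) \<and> edom h \<noteq> {}"

definition lsc :: "('a::topological_space \<Rightarrow> ereal) \<Rightarrow> bool" where
  "lsc h \<longleftrightarrow> (\<forall>x. h x \<le> Liminf (nhds x) h)"

definition convex_fun :: "('a::real_vector \<Rightarrow> ereal) \<Rightarrow> bool" where
  "convex_fun h \<longleftrightarrow> (\<forall>x y. \<forall>u\<ge>0. \<forall>v\<ge>0. u + v = 1 \<longrightarrow>
     h (u *\<^sub>R x + v *\<^sub>R y) \<le> ereal u * h x + ereal v * h y)"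

definition regular_subdiff :: "('a::real_inner \<Rightarrow> ereal) \<Rightarrow> 'a \<Rightarrow> 'a set" where
  "regular_subdiff h x = {v. \<bar>h x\<bar> \<noteq> \<infinity> \<and>
     0 \<le> Liminf (at x) (\<lambda>z. (h z - h x - ereal (v \<bullet> (z - x))) / ereal (norm (z - x)))}"

text \<open>The limiting (Mordukhovich) subdifferential; empty where \<open>h\<close> is not finite.\<close>

definition limiting_subdiff :: "('a::real_inner \<Rightarrow> ereal) \<Rightarrow> 'a \<Rightarrow> 'a set" where
  "limiting_subdiff h x = {v. \<bar>h x\<bar> \<noteq> \<infinity> \<and>
     (\<exists>X V. X \<longlonglongrightarrow> x \<and> (\<lambda>n. h (X n)) \<longlonglongrightarrow> h x \<and>
        (\<forall>n. V n \<in> regular_subdiff h (X n)) \<and> V \<longlonglongrightarrow> v)}"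

definition prox :: "('a::real_normed_vector \<Rightarrow> ereal) \<Rightarrow> 'a \<Rightarrow> 'a" where
  "prox g x = arg_min (\<lambda>z. ereal (1/2 * (norm (z - x))\<^sup>2) + g z) (\<lambda>_. True)"

text \<open>
  Distance to a set with the convention that the infimum over the empty set is \<open>\<infinity>\<close>
  (the library's \<open>infdist\<close> is \<open>0\<close> for the empty set).
\<close>

definition edist_to :: "'a::metric_space \<Rightarrow> 'a set \<Rightarrow> ereal" where
  "edist_to x A = (INF a\<in>A. ereal (dist x a))"

section \<open>Gradient and Hessian\<close>

definition grad :: "('a::real_inner \<Rightarrow> real) \<Rightarrow> 'a \<Rightarrow> 'a" where
  "grad \<phi> x = (THE D. GDERIV \<phi> x :> D)"

text \<open>
  \<open>gradf\<close> and \<open>hessf\<close> are meaningful at points near which the function is finite. The Hessian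
  is a bounded linear operator, so its continuity and Lipschitz continuity refer to the
  operator norm.
\<close>

definition gradf :: "('a::real_inner \<Rightarrow> ereal) \<Rightarrow> 'a \<Rightarrow> 'a" where
  "gradf f = grad (\<lambda>z. real_of_ereal (f z))"

definition hessf :: "('a::real_inner \<Rightarrow> ereal) \<Rightarrow> 'a \<Rightarrow> 'a \<Rightarrow>\<^sub>L 'a" where
  "hessf f x = (THE H. (gradf f has_derivative blinfun_apply H) (at x))"

definition twice_cont_diff_on :: "('a::real_inner \<Rightarrow> ereal) \<Rightarrow> 'a set \<Rightarrow> bool" where
  "twice_cont_diff_on f U \<longleftrightarrow>
     (\<forall>x\<in>U. \<bar>f x\<bar> \<noteq> \<infinity>) \<and>
     (\<forall>x\<in>U. \<exists>D. GDERIV (\<lambda>z. real_of_ereal (f z)) x :> D) \<and>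
     (\<forall>x\<in>U. gradf f differentiable (at x)) \<and>
     continuous_on U (hessf f)"

definition lambda_min :: "('a::real_normed_vector \<Rightarrow>\<^sub>L 'a) \<Rightarrow> real" where
  "lambda_min H = Min {l. \<exists>u. u \<noteq> 0 \<and> blinfun_apply H u = l *\<^sub>R u}"

definition strictly_continuous_on ::
    "'a::metric_space set \<Rightarrow> ('a \<Rightarrow> 'b::metric_space) \<Rightarrow> bool" where
  "strictly_continuous_on U \<phi> \<longleftrightarrow> (\<forall>x\<in>U. \<exists>\<delta>>0. \<exists>C. C-lipschitz_on (ball x \<delta> \<inter> U) \<phi>)"

section \<open>The composite problem\<close>

definition assm_A1 ::
    "('a::euclidean_space \<Rightarrow> ereal) \<Rightarrow> ('a \<Rightarrow> ereal) \<Rightarrow> 'a set \<Rightarrow> bool" where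
  "assm_A1 f g \<O> \<longleftrightarrow>
     proper f \<and> lsc f \<and>
     open \<O> \<and> closure (edom g) \<subseteq> \<O> \<and> twice_cont_diff_on f \<O> \<and>
     proper g \<and> lsc g \<and> convex_fun g \<and>
     (\<exists>m::real. \<forall>x. ereal m \<le> f x + g x)"

definition stationary ::
    "('a::euclidean_space \<Rightarrow> ereal) \<Rightarrow> ('a \<Rightarrow> ereal) \<Rightarrow> 'a set" where
  "stationary f g = {x. 0 \<in> limiting_subdiff (\<lambda>z. f z + g z) x}"

definition res :: "('a::euclidean_space \<Rightarrow> ereal) \<Rightarrow> ('a \<Rightarrow> ereal) \<Rightarrow> 'a \<Rightarrow> real" where
  "res f g x = norm (x - prox g (x - gradf f x))"

definition second_order_stationary ::
    "('a::euclidean_space \<Rightarrow> ereal) \<Rightarrow> ('a \<Rightarrow> ereal) \<Rightarrow> 'a set" where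
  "second_order_stationary f g = {x \<in> stationary f g.
     \<forall>z. (prox g z - x) \<bullet> blinfun_apply (hessf f x) (prox g z - x) \<ge> 0}"

section \<open>The algorithm\<close>

definition quad_model :: "('a::euclidean_space \<Rightarrow> ereal) \<Rightarrow> 'a \<Rightarrow> 'a \<Rightarrow> real" where
  "quad_model f xk x = real_of_ereal (f xk) + gradf f xk \<bullet> (x - xk)
     + 1/2 * (blinfun_apply (hessf f xk) (x - xk) \<bullet> (x - xk))"

definition reg_model ::
    "('a::euclidean_space \<Rightarrow> ereal) \<Rightarrow> real \<Rightarrow> 'a \<Rightarrow> real \<Rightarrow> 'a \<Rightarrow> real" where
  "reg_model f q xk L x = quad_model f xk x + L / q * norm (x - xk) powr q"

definition model_obj ::
    "('a::euclidean_space \<Rightarrow> ereal) \<Rightarrow> ('a \<Rightarrow> ereal) \<Rightarrow> real \<Rightarrow> 'a \<Rightarrow> real \<Rightarrow> 'a \<Rightarrow> ereal" where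
  "model_obj f g q xk L x = ereal (reg_model f q xk L x) + g x"

definition model_R ::
    "('a::euclidean_space \<Rightarrow> ereal) \<Rightarrow> ('a \<Rightarrow> ereal) \<Rightarrow> real \<Rightarrow> 'a \<Rightarrow> real \<Rightarrow> 'a \<Rightarrow> 'a" where
  "model_R f g q xk L x = x - prox g (x - grad (reg_model f q xk L) x)"

definition inexact_step ::
    "('a::euclidean_space \<Rightarrow> ereal) \<Rightarrow> ('a \<Rightarrow> ereal) \<Rightarrow> real \<Rightarrow> real \<Rightarrow> 'a \<Rightarrow> real \<Rightarrow> 'a \<Rightarrow> bool" where
  "inexact_step f g q \<rho> xk L y \<longleftrightarrow>
     norm (model_R f g q xk L y) \<le> \<rho> * L * norm (y - xk) powr (q - 1) \<and>
     model_obj f g q xk L y \<le> model_obj f g q xk L xk"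

definition sufficient_decrease ::
    "('a::euclidean_space \<Rightarrow> ereal) \<Rightarrow> ('a \<Rightarrow> ereal) \<Rightarrow> real \<Rightarrow> real \<Rightarrow> 'a \<Rightarrow> real \<Rightarrow> 'a \<Rightarrow> bool" where
  "sufficient_decrease f g q \<sigma> xk L y \<longleftrightarrow>
     f y + g y \<le> f xk + g xk - ereal (\<sigma> * L / q * norm (y - xk) powr q)"

text \<open>
  \<open>generated f g q Lm LM \<rho> \<sigma> \<tau> x LL yy jj\<close>: the inputs are admissible and \<open>x\<close> is a sequence of
  iterates of the algorithm, where \<open>LL k j\<close> and \<open>yy k j\<close> are the regularisation parameter and
  the trial point of inner iteration \<open>j\<close> and \<open>jj k\<close> is the index at which the inner loop of
  iteration \<open>k\<close> stops. The values \<open>LL k j\<close>, \<open>yy k j\<close> with \<open>j > jj k\<close> are unconstrained.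
\<close>

definition generated ::
    "('a::euclidean_space \<Rightarrow> ereal) \<Rightarrow> ('a \<Rightarrow> ereal) \<Rightarrow> real \<Rightarrow> real \<Rightarrow> real \<Rightarrow> real \<Rightarrow> real \<Rightarrow> real \<Rightarrow>
     (nat \<Rightarrow> 'a) \<Rightarrow> (nat \<Rightarrow> nat \<Rightarrow> real) \<Rightarrow> (nat \<Rightarrow> nat \<Rightarrow> 'a) \<Rightarrow> (nat \<Rightarrow> nat) \<Rightarrow> bool" where
  "generated f g q Lm LM \<rho> \<sigma> \<tau> x LL yy jj \<longleftrightarrow>
     q \<in> {2..3} \<and> 0 < Lm \<and> Lm < LM \<and> \<rho> \<in> {0<..<1} \<and> \<sigma> \<in> {0<..<1} \<and> 1 < \<tau> \<and> x 0 \<in> edom g \<and>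
     (\<forall>k.
        LL k 0 \<in> {Lm..LM} \<and>
        (q = 2 \<longrightarrow> LL k 0 > max 0 (- lambda_min (hessf f (x k)))) \<and>
        (\<forall>j\<le>jj k. inexact_step f g q \<rho> (x k) (LL k j) (yy k j)) \<and>
        (\<forall>j<jj k. \<not> sufficient_decrease f g q \<sigma> (x k) (LL k j) (yy k j) \<and>
                   LL k (Suc j) = \<tau> * LL k j) \<and>
        sufficient_decrease f g q \<sigma> (x k) (LL k (jj k)) (yy k (jj k)) \<and>
        (let y = yy k (jj k); v = model_R f g q (x k) (LL k (jj k)) y in
           x (Suc k) = (if f y + g y < f (y - v) + g (y - v) then y else y - v)))"

definition accumulation_points :: "(nat \<Rightarrow> 'a::topological_space) \<Rightarrow> 'a set" where
  "accumulation_points x = {z. \<exists>s. strict_mono s \<and> (x \<circ> s) \<longlonglongrightarrow> z}"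

definition assm_A2 ::
    "('a::euclidean_space \<Rightarrow> ereal) \<Rightarrow> 'a set \<Rightarrow> 'a set \<Rightarrow> (nat \<Rightarrow> 'a) \<Rightarrow> bool" where
  "assm_A2 f \<O> \<N> x \<longleftrightarrow>
     bounded (range x) \<and>
     open \<N> \<and> convex \<N> \<and> \<N> \<subseteq> \<O> \<and> accumulation_points x \<subseteq> \<N> \<and>
     strictly_continuous_on \<N> (hessf f)"

definition Q_superlinear_of_order :: "(nat \<Rightarrow> 'a::metric_space) \<Rightarrow> 'a \<Rightarrow> real \<Rightarrow> bool" where
  "Q_superlinear_of_order s l p \<longleftrightarrow> s \<longlonglongrightarrow> l \<and> 1 < p \<and>
     (\<exists>C. \<forall>\<^sub>F k in sequentially. dist (s (Suc k)) l \<le> C * dist (s k) l powr p)"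

end

theory Submission
  imports Defs
begin

text \<open>
  Let \<open>x\<close> be an iterate, \<open>y\<close> the accepted trial point, \<open>d\<close> the length of \<open>y - x\<close>, \<open>v\<close> the
  proximal residual of the model at \<open>y\<close>, and \<open>a\<close> a second-order stationary point close to
  \<open>xbar\<close>. Two estimates carry the theorem.

  First, \<open>d\<close> is at most \<open>\<eta>\<close> times the distance from \<open>x\<close> to \<open>a\<close>. Subgradients of \<open>g\<close> at the
  proximal point \<open>y - v\<close> and at \<open>a\<close> are monotone, and the Hessian at \<open>a\<close> is nonnegative in the
  direction \<open>y - v - a\<close>. What is left, up to Taylor remainders controlled by the Lipschitz
  constant of the Hessian, is the coercive term \<open>L d powr (q - 2)\<close> of the regulariser, and
  with it a quadratic inequality whose larger root is \<open>\<eta>\<close>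
  (\<open>step_monotonicity_estimate\<close>, \<open>step_length_le_distance\<close>). The infimum over \<open>a\<close> and the error
  bound give \<open>d \<le> \<eta> \<kappa> r\<^sup>\<gamma>\<close>, where \<open>r\<close> is the residual at \<open>x\<close>.

  Second, the residual at the next iterate is at most a constant times \<open>d powr (q - 1)\<close>,
  because the proximal mapping is nonexpansive (\<open>residual_after_step\<close>). Together the two
  estimates show that near \<open>xbar\<close> the residual contracts with order \<open>\<gamma> (q - 1)\<close>, which exceeds \<open>1\<close>.

  These estimates hold only near \<open>xbar\<close>, an accumulation point of the iterates. All
  step lengths and residuals tend to \<open>0\<close>, by sufficient decrease
  (\<open>step_lengths_tendsto_0\<close>). From some iterate near \<open>xbar\<close> on, the \<open>\<gamma>\<close>-th powers of the residuals are at
  least halved in each step; they dominate the steps, so the iterates stay near \<open>xbar\<close>,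
  converge to it, and their distance to \<open>xbar\<close> is at most a constant times \<open>r\<^sup>\<gamma>\<close>
  (\<open>trapped_near_accumulation_point\<close>). Comparing the residual at the next iterate with the
  distance from \<open>x\<close> to \<open>xbar\<close>, which is itself second-order stationary by closedness, yields
  the rate for the iterates.
\<close>

section \<open>Convex subgradients and the proximal mapping\<close>

text \<open>
  The subdifferential of convex analysis, defined by the global subgradient inequality and,
  like the limiting one, empty where the function is not finite. It is the form in which
  both optimality of a proximal point and stationarity are used below.
\<close>

definition convex_subdiff :: "('a::real_inner \<Rightarrow> ereal) \<Rightarrow> 'a \<Rightarrow> 'a set" where
  "convex_subdiff h p = {u. \<bar>h p\<bar> \<noteq> \<infinity> \<and> (\<forall>z. h p + ereal (u \<bullet> (z - p)) \<le> h z)}"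

text \<open>
  Add the two subgradient inequalities, each tested at the base point of the other.
\<close>

lemma convex_subdiff_monotone:
  assumes "u \<in> convex_subdiff h p" "w \<in> convex_subdiff h a"
  shows "0 \<le> (u - w) \<bullet> (p - a)"
proof -
  have "h p + ereal (u \<bullet> (a - p)) \<le> h a" "h a + ereal (w \<bullet> (p - a)) \<le> h p"
    and fin: "\<bar>h p\<bar> \<noteq> \<infinity>" "\<bar>h a\<bar> \<noteq> \<infinity>"
    using assms by (auto simp: convex_subdiff_def)
  moreover obtain \<alpha> \<beta> where "h p = ereal \<alpha>" "h a = ereal \<beta>"
    using fin by (metis ereal_real')
  ultimately have "\<alpha> + u \<bullet> (a - p) \<le> \<beta>" "\<beta> + w \<bullet> (p - a) \<le> \<alpha>"
    by auto
  then show ?thesis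
    by (simp add: inner_diff_left inner_diff_right)
qed

lemma lsc_sequentially:
  assumes "lsc h" "X \<longlonglongrightarrow> l" "(\<lambda>n. h (X n)) \<longlonglongrightarrow> c"
  shows "h l \<le> c"
proof (rule dense_le)
  fix y assume "y < h l"
  also have "h l \<le> Liminf (nhds l) h"
    using assms(1) by (simp add: lsc_def)
  finally have "\<forall>\<^sub>F z in nhds l. y < h z"
    using less_LiminfD by blast
  then have "\<forall>\<^sub>F n in sequentially. y < h (X n)"
    using assms(2) unfolding filterlim_iff by blast
  then show "y \<le> c"
    by (intro tendsto_lowerbound[OF assms(3)]) (auto elim: eventually_mono)
qed

text \<open>
  The direct method along a minimising sequence. The continuous real summand \<open>c\<close> is
  part of the statement because the function minimised by the proximal mapping is a sum of
  this kind, and the summand can be subtracted in \<open>ereal\<close> since it is finite.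
\<close>

lemma lsc_attains_min_on_compact:
  fixes h :: "'a::metric_space \<Rightarrow> ereal" and c :: "'a \<Rightarrow> real"
  assumes "lsc h" "continuous_on UNIV c" "compact K" "K \<noteq> {}"
  shows "\<exists>z\<in>K. \<forall>w\<in>K. ereal (c z) + h z \<le> ereal (c w) + h w"
proof -
  define \<phi> where "\<phi> z = ereal (c z) + h z" for z
  obtain u where u: "\<And>n. u n \<in> \<phi> ` K" "u \<longlonglongrightarrow> Inf (\<phi> ` K)"
    using Inf_as_limit[of "\<phi> ` K"] assms(4) by auto
  then have "\<forall>n. \<exists>s\<in>K. u n = \<phi> s"
    by blast
  then obtain s where s: "\<And>n. s n \<in> K" "\<And>n. u n = \<phi> (s n)"
    by metis
  obtain l r where l: "l \<in> K" "strict_mono r" "(s \<circ> r) \<longlonglongrightarrow> l"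
    using assms(3) s(1) unfolding compact_def by metis
  have "(\<lambda>n. c (s (r n))) \<longlonglongrightarrow> c l"
    using assms(2) l(3) by (auto simp: continuous_on_eq_continuous_at isCont_def o_def
        intro: isCont_tendsto_compose)
  then have "(\<lambda>n. u (r n) - ereal (c (s (r n)))) \<longlonglongrightarrow> Inf (\<phi> ` K) - ereal (c l)"
    using LIMSEQ_subseq_LIMSEQ[OF u(2) l(2)]
    by (intro tendsto_diff_ereal_general) (auto simp: o_def)
  moreover have "u (r n) - ereal (c (s (r n))) = h (s (r n))" for n
    by (cases "h (s (r n))") (auto simp: s(2) \<phi>_def)
  ultimately have "h l \<le> Inf (\<phi> ` K) - ereal (c l)"
    using lsc_sequentially[OF assms(1) l(3)] by (simp add: o_def)
  then have "\<phi> l \<le> Inf (\<phi> ` K)"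
    by (simp add: \<phi>_def ereal_le_minus add.commute)
  then show ?thesis
    using l(1) by (auto simp: \<phi>_def le_INF_iff)
qed

lemma proper_value_cases:
  assumes "proper h"
  obtains "h z = \<infinity>" | \<alpha> where "h z = ereal \<alpha>"
  using assms by (cases "h z") (auto simp: proper_def)

text \<open>
  On the unit ball around \<open>z0\<close> lower semicontinuity gives a finite minimum. A point
  outside the ball is seen along the segment from \<open>z0\<close>, which crosses the unit sphere;
  convexity on that segment turns the bound on the sphere into a bound that decreases at
  most linearly. This avoids any separation theorem.
\<close>

lemma convex_fun_linear_minorant:
  fixes g :: "'a::euclidean_space \<Rightarrow> ereal"
  assumes "proper g" "lsc g" "convex_fun g" "g z0 = ereal \<beta>"
  shows "\<exists>c\<ge>0. \<forall>z. ereal (- (c * (1 + norm (z - z0)))) \<le> g z"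
proof -
  obtain w0 where w0: "w0 \<in> cball z0 1" "\<And>w. w \<in> cball z0 1 \<Longrightarrow> g w0 \<le> g w"
    using lsc_attains_min_on_compact[OF assms(2), of "\<lambda>_. 0" "cball z0 1"]
    by (auto simp: zero_ereal_def[symmetric])
  have "g w0 \<le> ereal \<beta>"
    using w0(2)[of z0] assms(4) by simp
  then obtain m where m: "g w0 = ereal m"
    by (cases rule: proper_value_cases[OF assms(1), of w0]) auto
  have "ereal (- ((\<bar>m\<bar> + \<bar>\<beta>\<bar>) * (1 + norm (z - z0)))) \<le> g z" for z
  proof (cases "norm (z - z0) \<le> 1")
    case True
    then have "ereal m \<le> g z"
      using w0(2)[of z] m by (simp add: dist_norm norm_minus_commute)
    moreover have "- ((\<bar>m\<bar> + \<bar>\<beta>\<bar>) * (1 + norm (z - z0))) \<le> m"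
    proof -
      have "\<bar>m\<bar> * 1 \<le> (\<bar>m\<bar> + \<bar>\<beta>\<bar>) * (1 + norm (z - z0))"
        by (intro mult_mono) auto
      then show ?thesis by linarith
    qed
    ultimately show ?thesis
      by (metis ereal_less_eq(3) order_trans)
  next
    case False
    define t where "t = norm (z - z0)"
    have t: "t > 1" using False by (simp add: t_def)
    define w where "w = (1 - 1/t) *\<^sub>R z0 + (1/t) *\<^sub>R z"
    have "w - z0 = (1/t) *\<^sub>R (z - z0)"
      by (simp add: w_def algebra_simps)
    then have "norm (w - z0) = 1/t * t"
      using t by (simp add: t_def)
    then have "norm (w - z0) = 1"
      using t by simp
    then have "ereal m \<le> g w"
      using w0(2)[of w] m by (simp add: dist_norm norm_minus_commute)
    also have "g w \<le> ereal (1 - 1/t) * g z0 + ereal (1/t) * g z"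
      using assms(3) t unfolding convex_fun_def w_def by simp
    finally have le: "ereal m \<le> ereal (1 - 1/t) * g z0 + ereal (1/t) * g z" .
    show ?thesis
    proof (cases rule: proper_value_cases[OF assms(1), of z])
      case (2 \<alpha>)
      have "m \<le> (1 - 1/t) * \<beta> + (1/t) * \<alpha>"
        using le 2 assms(4) by simp
      then have "t * m \<le> t * ((1 - 1/t) * \<beta> + (1/t) * \<alpha>)"
        using t by (intro mult_left_mono) auto
      also have "\<dots> = (t - 1) * \<beta> + \<alpha>"
        using t by (simp add: field_simps)
      finally have "t * m - (t - 1) * \<beta> \<le> \<alpha>" by simp
      moreover have "t * \<bar>m\<bar> \<le> (1 + t) * \<bar>m\<bar>" "(t - 1) * \<bar>\<beta>\<bar> \<le> (1 + t) * \<bar>\<beta>\<bar>"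
        "- (t * \<bar>m\<bar>) \<le> t * m" "(t - 1) * \<beta> \<le> (t - 1) * \<bar>\<beta>\<bar>"
        using t abs_ge_minus_self[of m] mult_left_mono[of "-m" "\<bar>m\<bar>" t]
        by (auto intro: mult_right_mono mult_left_mono)
      ultimately have "- ((\<bar>m\<bar> + \<bar>\<beta>\<bar>) * (1 + t)) \<le> \<alpha>"
        by (simp add: algebra_simps)
      then show ?thesis
        using 2 by (simp add: t_def)
    qed simp
  qed
  then show ?thesis
    by (intro exI[of _ "\<bar>m\<bar> + \<bar>\<beta>\<bar>"]) auto
qed

text \<open>
  The constant \<open>prox\<close> is a choice of a minimiser, so this is the existence of one. The
  quadratic term beats the linear minorant of \<open>g\<close>; hence beyond a radius \<open>R\<close> no value is
  below the one at \<open>z0\<close>, and the minimum over the ball of radius \<open>R\<close> is global.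
\<close>

lemma prox_minimizes:
  fixes g :: "'a::euclidean_space \<Rightarrow> ereal"
  assumes "proper g" "lsc g" "convex_fun g"
  shows "ereal (1/2 * (norm (prox g x - x))\<^sup>2) + g (prox g x) \<le> ereal (1/2 * (norm (z - x))\<^sup>2) + g z"
proof -
  define \<phi> where "\<phi> z = ereal (1/2 * (norm (z - x))\<^sup>2) + g z" for z
  obtain z0 \<beta> where z0: "g z0 = ereal \<beta>"
    using assms(1) unfolding proper_def edom_def by (metis (mono_tags, lifting) Collect_empty_eq less_ereal.elims(2))
  obtain c where c: "c \<ge> 0" "\<And>z. ereal (- (c * (1 + norm (z - z0)))) \<le> g z"
    using convex_fun_linear_minorant[OF assms z0] by blast
  define D where "D = norm (z0 - x)"
  define b where "b = 1/2 * D\<^sup>2 + \<beta>"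
  have \<phi>z0: "\<phi> z0 = ereal b"
    by (simp add: \<phi>_def z0 b_def D_def)
  \<comment> \<open>At distance \<open>D + s\<close> from \<open>z0\<close> the value is at least \<open>s\<^sup>2 / 2 - c (1 + D + s)\<close>. The first
    bound on \<open>s\<close> makes this at least \<open>s - c (1 + D)\<close>, the second makes that exceed \<open>b\<close>.\<close>
  define R where "R = D + max (2*c + 2) (b + c * (1 + D) + 1)"
  have far: "\<phi> z0 \<le> \<phi> z" if "norm (z - z0) > R" for z
  proof -
    define t s where "t = norm (z - z0)" and "s = norm (z - z0) - D"
    have s: "s \<ge> 2*c + 2" "s \<ge> b + c * (1 + D)"
      using that by (auto simp: s_def R_def max_def split: if_splits)
    have "t \<le> norm (z - x) + D"
      unfolding t_def D_def by (metis norm_triangle_ineq4 diff_diff_eq2 add_diff_cancel_left' diff_add_cancel norm_minus_commute)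
    then have "s \<le> norm (z - x)" by (simp add: s_def t_def)
    moreover have "0 \<le> s" using s(1) c(1) by simp
    ultimately have "s\<^sup>2 \<le> (norm (z - x))\<^sup>2"
      by (intro power_mono) auto
    moreover have "s * (2*c + 2) \<le> s\<^sup>2"
      using s(1) \<open>0 \<le> s\<close> by (simp add: power2_eq_square mult_left_mono)
    ultimately have "s * c + s \<le> 1/2 * (norm (z - x))\<^sup>2"
      by (simp add: algebra_simps)
    moreover have "c * (1 + t) = c * s + c * (1 + D)"
      by (simp add: t_def s_def algebra_simps)
    ultimately have "b \<le> 1/2 * (norm (z - x))\<^sup>2 + - (c * (1 + t))"
      using s(2) by (simp add: algebra_simps)
    then have "ereal b \<le> ereal (1/2 * (norm (z - x))\<^sup>2) + ereal (- (c * (1 + t)))"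
      by simp
    also have "\<dots> \<le> \<phi> z"
      unfolding \<phi>_def t_def by (intro add_left_mono c(2))
    finally show ?thesis using \<phi>z0 by simp
  qed
  have "R \<ge> 0"
    using c(1) by (auto simp: R_def D_def max_def)
  have "\<exists>p\<in>cball z0 R. \<forall>w\<in>cball z0 R. \<phi> p \<le> \<phi> w"
    unfolding \<phi>_def using \<open>R \<ge> 0\<close>
    by (intro lsc_attains_min_on_compact assms(2)) (auto intro!: continuous_intros)
  then obtain p where p: "\<And>w. w \<in> cball z0 R \<Longrightarrow> \<phi> p \<le> \<phi> w"
    by blast
  have "\<phi> p \<le> \<phi> w" for w
  proof (cases "w \<in> cball z0 R")
    case False
    then have "\<phi> z0 \<le> \<phi> w"
      by (intro far) (simp add: dist_norm norm_minus_commute)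
    moreover have "\<phi> p \<le> \<phi> z0" using p[of z0] \<open>R \<ge> 0\<close> by simp
    ultimately show ?thesis by order
  qed (rule p)
  then have "is_arg_min \<phi> (\<lambda>_. True) p"
    by (auto simp: is_arg_min_def not_less)
  then have "is_arg_min \<phi> (\<lambda>_. True) (prox g x)"
    unfolding prox_def arg_min_def \<phi>_def by (rule someI)
  then show ?thesis
    by (auto simp: is_arg_min_def not_less \<phi>_def)
qed

text \<open>
  Compare \<open>p = prox g x\<close> with the points \<open>p + t (z - p)\<close> of a segment: convexity bounds the
  change of \<open>g\<close> linearly in \<open>t\<close>, the square contributes a term of order \<open>t\<^sup>2\<close>, and after
  division by \<open>t\<close> the limit \<open>t \<rightarrow> 0\<close> is the subgradient inequality.
\<close>

lemma prox_subgradient: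
  fixes g :: "'a::euclidean_space \<Rightarrow> ereal"
  assumes "proper g" "lsc g" "convex_fun g"
  shows "x - prox g x \<in> convex_subdiff g (prox g x)"
proof -
  define p where "p = prox g x"
  have min: "ereal (1/2 * (norm (p - x))\<^sup>2) + g p \<le> ereal (1/2 * (norm (z - x))\<^sup>2) + g z" for z
    unfolding p_def by (rule prox_minimizes[OF assms])
  obtain z0 where z0: "g z0 < \<infinity>"
    using assms(1) unfolding proper_def edom_def by blast
  obtain \<alpha> where \<alpha>: "g p = ereal \<alpha>"
    using min[of z0] z0 by (cases rule: proper_value_cases[OF assms(1), of p]) auto
  have "g p + ereal ((x - p) \<bullet> (z - p)) \<le> g z" for z
  proof (cases rule: proper_value_cases[OF assms(1), of z])
    case (2 \<beta>)
    have ineq: "0 \<le> (p - x) \<bullet> (z - p) + t/2 * (norm (z - p))\<^sup>2 + \<beta> - \<alpha>" if t: "0 < t" "t < 1" for t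
    proof -
      define w where "w = (1 - t) *\<^sub>R p + t *\<^sub>R z"
      have "g w \<le> ereal (1 - t) * g p + ereal t * g z"
        using assms(3) t unfolding convex_fun_def w_def by simp
      then have gw: "g w \<le> ereal ((1 - t) * \<alpha> + t * \<beta>)"
        using \<alpha> 2 by simp
      have "w - x = (p - x) + t *\<^sub>R (z - p)"
        by (simp add: w_def algebra_simps)
      then have nw: "(norm (w - x))\<^sup>2 = (norm (p - x))\<^sup>2 + 2 * t * ((p - x) \<bullet> (z - p)) + t\<^sup>2 * (norm (z - p))\<^sup>2"
        by (simp only: power2_norm_eq_inner)
          (simp add: inner_add_left inner_add_right inner_commute power2_eq_square algebra_simps)
      have "ereal (1/2 * (norm (p - x))\<^sup>2) + g p \<le> ereal (1/2 * (norm (w - x))\<^sup>2) + ereal ((1 - t) * \<alpha> + t * \<beta>)"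
        using min[of w] add_left_mono[OF gw] by (rule order_trans)
      then have "1/2 * (norm (p - x))\<^sup>2 + \<alpha> \<le> 1/2 * (norm (w - x))\<^sup>2 + ((1 - t) * \<alpha> + t * \<beta>)"
        by (simp add: \<alpha>)
      then have "0 \<le> t * ((p - x) \<bullet> (z - p) + t/2 * (norm (z - p))\<^sup>2 + \<beta> - \<alpha>)"
        unfolding nw by (simp add: algebra_simps power2_eq_square)
      then show ?thesis
        using t(1) zero_le_mult_iff[of t] by auto
    qed
    have "((\<lambda>t. (p - x) \<bullet> (z - p) + t/2 * (norm (z - p))\<^sup>2 + \<beta> - \<alpha>) \<longlongrightarrow>
        (p - x) \<bullet> (z - p) + 0/2 * (norm (z - p))\<^sup>2 + \<beta> - \<alpha>) (at_right 0)"
      by (intro tendsto_intros) simp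
    moreover have "\<forall>\<^sub>F t in at_right 0. 0 \<le> (p - x) \<bullet> (z - p) + t/2 * (norm (z - p))\<^sup>2 + \<beta> - \<alpha>"
      by (rule eventually_mono[OF eventually_at_right_real[of 0 "1::real"]], simp, rule ineq, auto)
    ultimately have "0 \<le> (p - x) \<bullet> (z - p) + 0/2 * (norm (z - p))\<^sup>2 + \<beta> - \<alpha>"
      by (intro tendsto_lowerbound) auto
    then show ?thesis
      using \<alpha> 2 by (simp add: inner_diff_left)
  qed simp
  then show ?thesis
    unfolding p_def[symmetric] by (simp add: convex_subdiff_def \<alpha>)
qed

lemma prox_eq_iff:
  fixes g :: "'a::euclidean_space \<Rightarrow> ereal"
  assumes "proper g" "lsc g" "convex_fun g"
  shows "prox g x = p \<longleftrightarrow> x - p \<in> convex_subdiff g p"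
proof
  assume "x - p \<in> convex_subdiff g p"
  from convex_subdiff_monotone[OF prox_subgradient[OF assms, of x] this]
  have "0 \<le> - ((prox g x - p) \<bullet> (prox g x - p))"
    by (simp add: inner_diff_left inner_diff_right inner_commute)
  then show "prox g x = p"
    by (metis inner_gt_zero_iff neg_0_le_iff_le not_le right_minus_eq)
qed (use prox_subgradient[OF assms] in blast)

text \<open>
  Monotonicity of the subgradients \<open>u - prox g u\<close> and \<open>w - prox g w\<close>, followed by the
  Cauchy-Schwarz inequality.
\<close>

lemma prox_nonexpansive:
  fixes g :: "'a::euclidean_space \<Rightarrow> ereal"
  assumes "proper g" "lsc g" "convex_fun g"
  shows "norm (prox g u - prox g w) \<le> norm (u - w)"
proof -
  let ?d = "prox g u - prox g w"
  have "0 \<le> ((u - prox g u) - (w - prox g w)) \<bullet> ?d"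
    by (rule convex_subdiff_monotone[OF prox_subgradient[OF assms] prox_subgradient[OF assms]])
  then have "norm ?d * norm ?d \<le> (u - w) \<bullet> ?d"
    by (simp add: inner_diff_left power2_norm_eq_inner flip: power2_eq_square)
  also have "\<dots> \<le> norm (u - w) * norm ?d"
    by (rule norm_cauchy_schwarz)
  finally show ?thesis
    by (cases "norm ?d = 0") (auto simp: mult_le_cancel_right)
qed

section \<open>Gradients and Hessians\<close>

lemma GDERIV_unique:
  assumes "GDERIV \<phi> x :> D" "GDERIV \<phi> x :> E"
  shows "D = E"
proof -
  have "(\<lambda>h. h \<bullet> D) = (\<lambda>h. h \<bullet> E)"
    using assms unfolding gderiv_def by (rule has_derivative_unique)
  then show ?thesis
    by (metis vector_eq_ldot)
qed

lemma grad_eqI: "GDERIV \<phi> x :> D \<Longrightarrow> grad \<phi> x = D"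
  unfolding grad_def by (blast intro: the_equality GDERIV_unique)

lemma gradf_GDERIV:
  assumes "twice_cont_diff_on f U" "x \<in> U"
  shows "GDERIV (\<lambda>z. real_of_ereal (f z)) x :> gradf f x"
  using assms grad_eqI unfolding twice_cont_diff_on_def gradf_def by metis

lemma hessf_has_derivative:
  assumes "twice_cont_diff_on f U" "x \<in> U"
  shows "(gradf f has_derivative blinfun_apply (hessf f x)) (at x)"
proof -
  obtain D where D: "(gradf f has_derivative D) (at x)"
    using assms unfolding twice_cont_diff_on_def differentiable_def by metis
  then have "(gradf f has_derivative blinfun_apply (Blinfun D)) (at x)"
    by (simp add: bounded_linear_Blinfun_apply has_derivative_bounded_linear)
  moreover have "H = Blinfun D" if "(gradf f has_derivative blinfun_apply H) (at x)" for H
    using has_derivative_unique[OF that calculation] by (simp add: blinfun_apply_inject)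
  ultimately show ?thesis
    unfolding hessf_def by (rule theI)
qed

lemma gradf_isCont:
  assumes "twice_cont_diff_on f U" "x \<in> U"
  shows "isCont (gradf f) x"
  using hessf_has_derivative[OF assms] by (rule has_derivative_continuous)

lemma hessf_isCont:
  assumes "twice_cont_diff_on f U" "open U" "x \<in> U"
  shows "isCont (hessf f) x"
  using assms by (simp add: twice_cont_diff_on_def continuous_on_eq_continuous_at)

lemma DERIV_along_line:
  assumes "GDERIV \<phi> (x + t *\<^sub>R u) :> D"
  shows "((\<lambda>t. \<phi> (x + t *\<^sub>R u)) has_real_derivative u \<bullet> D) (at t)"
proof -
  have "((\<lambda>t. x + t *\<^sub>R u) has_derivative (\<lambda>h. h *\<^sub>R u)) (at t)"
    by (auto intro!: derivative_eq_intros)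
  from has_derivative_compose[OF this assms[unfolded gderiv_def]]
  show ?thesis
    by (simp add: has_field_derivative_def mult_commute_abs)
qed

lemma DERIV_inner_along_line:
  assumes "(G has_derivative H) (at (x + t *\<^sub>R u))"
  shows "((\<lambda>t. c \<bullet> G (x + t *\<^sub>R u)) has_real_derivative c \<bullet> H u) (at t)"
proof -
  have "((\<lambda>t. x + t *\<^sub>R u) has_derivative (\<lambda>h. h *\<^sub>R u)) (at t)"
    by (auto intro!: derivative_eq_intros)
  from has_derivative_inner_right[OF has_derivative_compose[OF this assms], of c]
  show ?thesis
    using linear_cmul[OF has_derivative_linear[OF assms]]
    by (simp add: has_field_derivative_def mult_commute_abs)
qed

text \<open>
  Two applications of the mean value theorem, first in direction \<open>u\<close> and then in direction
  \<open>w\<close>. The left-hand side is symmetric in \<open>u\<close> and \<open>w\<close>, the right-hand side is not visibly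
  so: this is what makes the Hessian symmetric.
\<close>

lemma mixed_second_difference:
  assumes G: "\<And>z. z \<in> ball x e \<Longrightarrow> GDERIV \<phi> z :> G z"
    and H: "\<And>z. z \<in> ball x e \<Longrightarrow> (G has_derivative blinfun_apply (H z)) (at z)"
    and uw: "norm u + norm w < e"
  shows "\<exists>z. norm (z - x) \<le> norm u + norm w \<and>
    \<phi> (x + u + w) - \<phi> (x + u) - \<phi> (x + w) + \<phi> x = u \<bullet> H z w"
proof -
  have near: "norm (s *\<^sub>R u + t *\<^sub>R w) \<le> norm u + norm w" if "0 \<le> s" "s \<le> 1" "0 \<le> t" "t \<le> 1" for s t
    using that by (intro order.trans[OF norm_triangle_ineq] add_mono) (auto intro: mult_left_le_one_le)
  have inball: "x + s *\<^sub>R u + t *\<^sub>R w \<in> ball x e" if "0 \<le> s" "s \<le> 1" "0 \<le> t" "t \<le> 1" for s t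
  proof -
    have "dist x (x + s *\<^sub>R u + t *\<^sub>R w) = norm (s *\<^sub>R u + t *\<^sub>R w)"
      by (metis add.assoc add_diff_cancel_left' dist_commute dist_norm)
    then show ?thesis
      using near[OF that] uw by simp
  qed
  define h where "h s = \<phi> (x + w + s *\<^sub>R u) - \<phi> (x + s *\<^sub>R u)" for s
  have "(h has_real_derivative u \<bullet> G (x + w + s *\<^sub>R u) - u \<bullet> G (x + s *\<^sub>R u)) (at s)"
    if "0 \<le> s" "s \<le> 1" for s
    unfolding h_def using inball[OF that, of 1] inball[OF that, of 0]
    by (intro DERIV_diff DERIV_along_line G) (simp_all add: algebra_simps)
  then obtain s where s: "0 < s" "s < 1" "h 1 - h 0 = u \<bullet> G (x + w + s *\<^sub>R u) - u \<bullet> G (x + s *\<^sub>R u)"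
    using MVT2[of 0 1 h "\<lambda>s. u \<bullet> G (x + w + s *\<^sub>R u) - u \<bullet> G (x + s *\<^sub>R u)"] by auto
  have "((\<lambda>t. u \<bullet> G (x + s *\<^sub>R u + t *\<^sub>R w)) has_real_derivative u \<bullet> H (x + s *\<^sub>R u + t *\<^sub>R w) w) (at t)"
    if "0 \<le> t" "t \<le> 1" for t
    using s that by (intro DERIV_inner_along_line H inball) auto
  then obtain t where t: "0 < t" "t < 1"
    "u \<bullet> G (x + s *\<^sub>R u + 1 *\<^sub>R w) - u \<bullet> G (x + s *\<^sub>R u + 0 *\<^sub>R w) = u \<bullet> H (x + s *\<^sub>R u + t *\<^sub>R w) w"
    using MVT2[of 0 1 "\<lambda>t. u \<bullet> G (x + s *\<^sub>R u + t *\<^sub>R w)" "\<lambda>t. u \<bullet> H (x + s *\<^sub>R u + t *\<^sub>R w) w"] by auto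
  have "h 1 - h 0 = u \<bullet> H (x + s *\<^sub>R u + t *\<^sub>R w) w"
    using s(3) t(3) by (simp add: algebra_simps)
  then show ?thesis
    using near[of s t] s t
    by (intro exI[of _ "x + s *\<^sub>R u + t *\<^sub>R w"]) (auto simp: h_def algebra_simps)
qed

text \<open>
  Schwarz's theorem. Only because of this symmetry does the quadratic term of the model have the
  gradient \<open>hessf f x (y - x)\<close> at \<open>y\<close>.
\<close>

lemma hessf_symmetric:
  assumes C2: "twice_cont_diff_on f U" and U: "open U" "x \<in> U"
  shows "u \<bullet> hessf f x w = w \<bullet> hessf f x u"
proof -
  let ?\<phi> = "\<lambda>z. real_of_ereal (f z)"
  obtain e where e: "e > 0" "ball x e \<subseteq> U"
    using U openE by blast
  define N where "N = norm u + norm w"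
  \<comment> \<open>Scales that tend to \<open>0\<close> and keep the whole parallelogram inside the ball.\<close>
  define s where "s n = e / (N + 1) / real (Suc n)" for n
  have N: "N \<ge> 0" by (simp add: N_def)
  have s: "s n > 0" for n
    using e(1) N by (simp add: s_def)
  have "s n * N < e" for n
  proof -
    have "s n \<le> e / (N + 1) / 1"
      unfolding s_def using e(1) N by (intro divide_left_mono) auto
    then have "s n * N \<le> e / (N + 1) * N"
      using N by (intro mult_right_mono) auto
    also have "\<dots> < e" using e(1) N by (simp add: field_simps)
    finally show ?thesis .
  qed
  then have small: "norm (s n *\<^sub>R u) + norm (s n *\<^sub>R w) < e" "norm (s n *\<^sub>R w) + norm (s n *\<^sub>R u) < e"
    and sN: "norm (s n *\<^sub>R u) + norm (s n *\<^sub>R w) = s n * N" for n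
    using s[of n] by (simp_all add: N_def algebra_simps)
  have G: "GDERIV ?\<phi> z :> gradf f z" and H: "(gradf f has_derivative blinfun_apply (hessf f z)) (at z)"
    if "z \<in> ball x e" for z
    using that e(2) gradf_GDERIV[OF C2] hessf_has_derivative[OF C2] by auto
  have "\<exists>z z'. norm (z - x) \<le> s n * N \<and> norm (z' - x) \<le> s n * N \<and>
    u \<bullet> hessf f z w = w \<bullet> hessf f z' u" for n
  proof -
    obtain z where z: "norm (z - x) \<le> s n * N"
      "?\<phi> (x + s n *\<^sub>R u + s n *\<^sub>R w) - ?\<phi> (x + s n *\<^sub>R u) - ?\<phi> (x + s n *\<^sub>R w) + ?\<phi> x
        = (s n *\<^sub>R u) \<bullet> hessf f z (s n *\<^sub>R w)"
      using mixed_second_difference[OF G H small(1)] sN by metis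
    obtain z' where z': "norm (z' - x) \<le> s n * N"
      "?\<phi> (x + s n *\<^sub>R w + s n *\<^sub>R u) - ?\<phi> (x + s n *\<^sub>R w) - ?\<phi> (x + s n *\<^sub>R u) + ?\<phi> x
        = (s n *\<^sub>R w) \<bullet> hessf f z' (s n *\<^sub>R u)"
      using mixed_second_difference[OF G H small(2)] sN by (metis add.commute)
    have "x + s n *\<^sub>R w + s n *\<^sub>R u = x + s n *\<^sub>R u + s n *\<^sub>R w"
      by (simp add: algebra_simps)
    then have "(s n *\<^sub>R u) \<bullet> hessf f z (s n *\<^sub>R w) = (s n *\<^sub>R w) \<bullet> hessf f z' (s n *\<^sub>R u)"
      using z(2) z'(2) by (metis diff_diff_eq add.commute)
    then have "u \<bullet> hessf f z w = w \<bullet> hessf f z' u"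
      using s[of n] by (simp add: blinfun.scaleR_right)
    then show ?thesis using z(1) z'(1) by blast
  qed
  then obtain z z' where z: "\<And>n. norm (z n - x) \<le> s n * N" "\<And>n. norm (z' n - x) \<le> s n * N"
    "\<And>n. u \<bullet> hessf f (z n) w = w \<bullet> hessf f (z' n) u"
    by metis
  have "(\<lambda>n. s n * N) \<longlonglongrightarrow> 0"
  proof -
    have "(\<lambda>n. e / (N + 1) * inverse (real (Suc n)) * N) \<longlonglongrightarrow> e / (N + 1) * 0 * N"
      by (intro tendsto_intros LIMSEQ_inverse_real_of_nat)
    then show ?thesis by (simp add: s_def divide_inverse)
  qed
  then have "z \<longlonglongrightarrow> x" "z' \<longlonglongrightarrow> x"
    using z(1,2) by (auto intro!: LIM_zero_cancel[of _ x] Lim_null_comparison[of _ "\<lambda>n. s n * N"])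
  then have "(\<lambda>n. hessf f (z n)) \<longlonglongrightarrow> hessf f x" "(\<lambda>n. hessf f (z' n)) \<longlonglongrightarrow> hessf f x"
    using hessf_isCont[OF C2 U] isCont_tendsto_compose by blast+
  then have "(\<lambda>n. u \<bullet> hessf f (z n) w) \<longlonglongrightarrow> u \<bullet> hessf f x w"
    "(\<lambda>n. w \<bullet> hessf f (z' n) u) \<longlonglongrightarrow> w \<bullet> hessf f x u"
    by (auto intro!: tendsto_intros)
  then show ?thesis
    unfolding z(3) by (rule LIMSEQ_unique)
qed

text \<open>
  The remainder \<open>e\<close> is tested against itself: along the segment from \<open>a\<close> to \<open>z\<close> the scalar
  function \<open>e \<bullet> G\<close>, minus its linear part and minus the claimed bound, has a nonpositive
  derivative. This replaces the integral form of the remainder.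
\<close>

lemma gradient_taylor_bound:
  fixes H :: "'a::real_inner \<Rightarrow> 'a \<Rightarrow>\<^sub>L 'a"
  assumes H: "\<And>p. p \<in> S \<Longrightarrow> (G has_derivative blinfun_apply (H p)) (at p)"
    and lip: "L-lipschitz_on S H" and S: "convex S" "a \<in> S" "z \<in> S"
  shows "norm (G z - G a - H a (z - a)) \<le> L / 2 * (norm (z - a))\<^sup>2"
proof -
  define d e where "d = z - a" and "e = G z - G a - H a (z - a)"
  define k where "k t = e \<bullet> G (a + t *\<^sub>R d) - t * (e \<bullet> H a d) - t\<^sup>2 * (L / 2 * (norm d)\<^sup>2 * norm e)" for t
  have "\<exists>y. (k has_real_derivative y) (at t) \<and> y \<le> 0" if t: "0 \<le> t" "t \<le> 1" for t
  proof -
    let ?p = "a + t *\<^sub>R d"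
    have "?p = (1 - t) *\<^sub>R a + t *\<^sub>R z" by (simp add: d_def algebra_simps)
    then have p: "?p \<in> S"
      using t S by (simp add: convexD_alt)
    have "(k has_real_derivative e \<bullet> H ?p d - e \<bullet> H a d - t * (L * (norm d)\<^sup>2 * norm e)) (at t)"
      unfolding k_def by (auto intro!: derivative_eq_intros DERIV_inner_along_line H p)
    moreover have "norm (H ?p d - H a d) \<le> L * (t * norm d) * norm d"
    proof -
      have "norm (H ?p d - H a d) \<le> norm (H ?p - H a) * norm d"
        by (metis norm_blinfun blinfun.diff_left)
      also have "norm (H ?p - H a) \<le> L * dist ?p a"
        using lipschitz_onD[OF lip p S(2)] by (simp add: dist_norm)
      finally show ?thesis using t by (simp add: dist_norm mult_right_mono)
    qed
    then have "norm e * norm (H ?p d - H a d) \<le> norm e * (L * (t * norm d) * norm d)"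
      by (intro mult_left_mono) auto
    then have "e \<bullet> (H ?p d - H a d) \<le> t * (L * (norm d)\<^sup>2 * norm e)"
      using norm_cauchy_schwarz[of e "H ?p d - H a d"]
      by (simp add: power2_eq_square algebra_simps)
    ultimately show ?thesis
      by (intro exI conjI) (auto simp: inner_diff_right)
  qed
  then have "k 1 \<le> k 0"
    using DERIV_nonpos_imp_nonincreasing[of 0 1 k] by simp
  then have "e \<bullet> G z - e \<bullet> H a d - L / 2 * (norm d)\<^sup>2 * norm e \<le> e \<bullet> G a"
    by (simp add: k_def d_def)
  then have "e \<bullet> (G z - G a - H a d) \<le> L / 2 * (norm d)\<^sup>2 * norm e"
    by (simp add: inner_diff_right)
  moreover have e: "G z - G a - H a d = e"
    by (simp add: e_def d_def)
  ultimately have "norm e * norm e \<le> L / 2 * (norm d)\<^sup>2 * norm e"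
    by (metis power2_norm_eq_inner power2_eq_square)
  moreover have "0 \<le> L" using lip by (rule lipschitz_on_nonneg)
  ultimately show ?thesis
    unfolding d_def[symmetric] e
    by (cases "norm e = 0") (auto simp: mult_le_cancel_right)
qed

text \<open>
  Difference quotients of \<open>G\<close> in direction \<open>u\<close>, paired with \<open>D u\<close>, are bounded by
  \<open>L * norm u * norm (D u)\<close>, and so is their limit.
\<close>

lemma derivative_bound_of_lipschitz:
  fixes G :: "'a::real_inner \<Rightarrow> 'a"
  assumes D: "(G has_derivative D) (at a)" and lip: "L-lipschitz_on S G" and a: "a \<in> interior S"
  shows "norm (D u) \<le> L * norm u"
proof -
  define c where "c = D u"
  have "((\<lambda>t. c \<bullet> G (a + t *\<^sub>R u)) has_real_derivative c \<bullet> D u) (at 0)"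
    using D by (intro DERIV_inner_along_line) simp
  then have lim: "(\<lambda>h. (c \<bullet> G (a + h *\<^sub>R u) - c \<bullet> G a) / h) \<midarrow>0\<rightarrow> c \<bullet> D u"
    by (simp add: DERIV_def)
  have "((\<lambda>h. a + h *\<^sub>R u) \<longlongrightarrow> a + 0 *\<^sub>R u) (at (0::real))"
    by (intro tendsto_intros)
  then have "\<forall>\<^sub>F h in at 0. a + h *\<^sub>R u \<in> interior S"
    using a by (auto dest: topological_tendstoD[of _ _ _ "interior S"])
  then have "\<forall>\<^sub>F h in at 0. (c \<bullet> G (a + h *\<^sub>R u) - c \<bullet> G a) / h \<le> norm c * (L * norm u)"
    using eventually_neq_at_within[of 0 "0::real" UNIV]
  proof eventually_elim
    case (elim h)
    then have "a + h *\<^sub>R u \<in> S" "a \<in> S"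
      using a interior_subset by auto
    from lipschitz_onD[OF lip this] have "norm (G (a + h *\<^sub>R u) - G a) \<le> L * (\<bar>h\<bar> * norm u)"
      by (simp add: dist_norm)
    then have "norm c * norm (G (a + h *\<^sub>R u) - G a) \<le> norm c * (L * (\<bar>h\<bar> * norm u))"
      by (intro mult_left_mono) auto
    then have "\<bar>c \<bullet> (G (a + h *\<^sub>R u) - G a)\<bar> \<le> norm c * (L * (\<bar>h\<bar> * norm u))"
      using Cauchy_Schwarz_ineq2 order_trans by blast
    then have "\<bar>c \<bullet> G (a + h *\<^sub>R u) - c \<bullet> G a\<bar> / \<bar>h\<bar> \<le> norm c * (L * norm u)"
      using elim(2) by (simp add: inner_diff_right divide_le_eq mult_ac)
    then show ?case
      by (metis abs_divide abs_le_D1)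
  qed
  then have "c \<bullet> D u \<le> norm c * (L * norm u)"
    by (intro tendsto_upperbound[OF lim]) auto
  then have "norm c * norm c \<le> norm c * (L * norm u)"
    by (simp add: c_def power2_norm_eq_inner flip: power2_eq_square)
  moreover have "0 \<le> L" using lip by (rule lipschitz_on_nonneg)
  ultimately show ?thesis
    unfolding c_def[symmetric] by (cases "norm c = 0") auto
qed

section \<open>The regularised model\<close>

text \<open>
  At \<open>y = c\<close> the norm is not differentiable, but its power is \<open>o(norm h)\<close> since \<open>1 < q\<close>, so
  the formula, whose value is \<open>0\<close> there, remains correct.
\<close>

lemma GDERIV_norm_powr:
  fixes c :: "'a::real_inner"
  assumes "1 < q"
  shows "GDERIV (\<lambda>z. norm (z - c) powr q) y :> (q * norm (y - c) powr (q - 2)) *\<^sub>R (y - c)"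
proof (cases "y = c")
  case False
  have shift: "((\<lambda>z. z - c) has_derivative (\<lambda>h. h)) (at y)"
    by (auto intro!: derivative_eq_intros)
  have "(norm has_derivative (\<lambda>h. h \<bullet> sgn (y - c))) (at (y - c))"
    using False by (intro has_derivative_norm) simp
  from has_derivative_compose[OF shift this]
  have "((\<lambda>z. norm (z - c)) has_derivative (\<lambda>h. h \<bullet> sgn (y - c))) (at y)" .
  moreover have "DERIV (\<lambda>t. t powr q) (norm (y - c)) :> q * norm (y - c) powr (q - 1)"
    using False by (intro has_real_derivative_powr) simp
  ultimately have "GDERIV (\<lambda>z. norm (z - c) powr q) y :> (q * norm (y - c) powr (q - 1)) *\<^sub>R sgn (y - c)"
    by (intro GDERIV_DERIV_compose) (simp_all add: gderiv_def)
  also have "(q * norm (y - c) powr (q - 1)) *\<^sub>R sgn (y - c) = (q * norm (y - c) powr (q - 2)) *\<^sub>R (y - c)"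
    using False powr_add[of "norm (y - c)" "q - 2" 1]
    by (simp add: sgn_div_norm powr_minus divide_inverse)
  finally show ?thesis .
next
  case True
  have "((\<lambda>h. norm h powr (q - 1)) \<longlongrightarrow> 0) (at (0::'a))"
    using assms by (intro tendsto_zero_powrI[where b = "q - 1"] tendsto_norm_zero tendsto_ident_at tendsto_const) auto
  moreover have "norm (norm h powr q) / norm h = norm h powr (q - 1)" for h :: 'a
    by (cases "h = 0") (auto simp: powr_diff)
  ultimately show ?thesis
    using True assms by (simp add: gderiv_def has_derivative_at)
qed

lemma reg_model_GDERIV:
  assumes C2: "twice_cont_diff_on f U" and U: "open U" "xk \<in> U" and q: "1 < q"
  shows "GDERIV (reg_model f q xk L) y :>
    gradf f xk + hessf f xk (y - xk) + (L * norm (y - xk) powr (q - 2)) *\<^sub>R (y - xk)"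
proof -
  let ?H = "hessf f xk"
  have "((\<lambda>x. 1/2 * (?H (x - xk) \<bullet> (x - xk))) has_derivative
      (\<lambda>h. 1/2 * (?H (y - xk) \<bullet> h + ?H h \<bullet> (y - xk)))) (at y)"
    by (auto intro!: derivative_eq_intros)
  moreover have "?H h \<bullet> (y - xk) = h \<bullet> ?H (y - xk)" for h
    using hessf_symmetric[OF C2 U, of "y - xk" h] by (simp add: inner_commute)
  ultimately have quad: "GDERIV (\<lambda>x. 1/2 * (?H (x - xk) \<bullet> (x - xk))) y :> ?H (y - xk)"
    by (simp add: gderiv_def inner_commute)
  have lin: "GDERIV (\<lambda>x. real_of_ereal (f xk) + gradf f xk \<bullet> (x - xk)) y :> gradf f xk"
    unfolding gderiv_def by (auto intro!: derivative_eq_intros simp: inner_commute)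
  have pow: "GDERIV (\<lambda>x. L / q * norm (x - xk) powr q) y :> (L * norm (y - xk) powr (q - 2)) *\<^sub>R (y - xk)"
    using GDERIV_mult[OF GDERIV_const GDERIV_norm_powr[OF q], of "L / q" xk y] q by simp
  show ?thesis
    unfolding reg_model_def quad_model_def by (intro GDERIV_add lin quad pow)
qed

section \<open>Stationary points of the composite problem\<close>

lemma assm_A1_D:
  assumes "assm_A1 f g U"
  shows "proper f" "open U" "edom g \<subseteq> U" "twice_cont_diff_on f U" "proper g" "lsc g" "convex_fun g"
  using assms closure_subset[of "edom g"] unfolding assm_A1_def by auto

text \<open>
  The smooth part \<open>f\<close> is finite on the domain of \<open>g\<close>, so the domain of the sum is that of
  \<open>g\<close>.
\<close>

lemma composite_finite_iff:
  assumes A1: "assm_A1 f g U"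
  shows "\<bar>f x + g x\<bar> \<noteq> \<infinity> \<longleftrightarrow> x \<in> edom g"
proof
  assume x: "x \<in> edom g"
  then have "\<bar>f x\<bar> \<noteq> \<infinity>"
    using assm_A1_D(3,4)[OF A1] unfolding twice_cont_diff_on_def by (metis subsetD)
  moreover have "g x \<noteq> \<infinity>" "g x \<noteq> -\<infinity>"
    using x assm_A1_D(5)[OF A1] by (auto simp: edom_def proper_def)
  ultimately
  show "\<bar>f x + g x\<bar> \<noteq> \<infinity>"
    by (cases "f x"; cases "g x") auto
next
  assume "\<bar>f x + g x\<bar> \<noteq> \<infinity>"
  then have "g x \<noteq> \<infinity>"
    using assm_A1_D(1)[OF A1] by (cases "f x") (auto simp: proper_def)
  then show "x \<in> edom g" by (simp add: edom_def)
qed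

lemma edom_values:
  assumes A1: "assm_A1 f g U" and "x \<in> edom g"
  obtains \<alpha> where "g x = ereal \<alpha>" "f x = ereal (real_of_ereal (f x))"
proof -
  have "\<bar>f x\<bar> \<noteq> \<infinity>"
    using assm_A1_D(3,4)[OF A1] assms(2) unfolding twice_cont_diff_on_def by (metis subsetD)
  then have "f x = ereal (real_of_ereal (f x))"
    by (metis ereal_real)
  then show thesis
    using that assms(2) assm_A1_D(5)[OF A1] by (cases "g x") (auto simp: edom_def proper_def)
qed

lemma GDERIV_linear_approximation:
  assumes "GDERIV \<phi> x :> D" "e > 0"
  obtains d where "d > 0" "\<And>z. norm (z - x) < d \<Longrightarrow> \<bar>\<phi> z - \<phi> x - D \<bullet> (z - x)\<bar> \<le> e * norm (z - x)"
proof -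
  have "\<exists>d>0. \<forall>z. norm (z - x) < d \<longrightarrow> norm (\<phi> z - \<phi> x - (z - x) \<bullet> D) \<le> e * norm (z - x)"
    using assms unfolding gderiv_def has_derivative_within_alt by simp
  then show thesis
    using that by (auto simp: inner_commute)
qed

text \<open>
  The smooth part contributes its gradient up to \<open>o(norm (z - x))\<close>. So a regular
  subgradient of the sum gives, after subtraction of the gradient, a local first-order
  lower bound of \<open>g\<close>; convexity along the segment from \<open>x\<close> to \<open>z\<close> makes this bound exact and
  global. The converse only adds the two first-order bounds.
\<close>

lemma regular_subdiff_sum_iff:
  fixes f g :: "'a::euclidean_space \<Rightarrow> ereal"
  assumes A1: "assm_A1 f g U"
  shows "v \<in> regular_subdiff (\<lambda>z. f z + g z) x \<longleftrightarrow> v - gradf f x \<in> convex_subdiff g x"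
proof (cases "x \<in> edom g")
  case False
  then have "\<not> \<bar>f x + g x\<bar> \<noteq> \<infinity>" "\<not> \<bar>g x\<bar> \<noteq> \<infinity>"
    using composite_finite_iff[OF A1] by (auto simp: edom_def)
  then show ?thesis
    by (simp only: regular_subdiff_def convex_subdiff_def mem_Collect_eq) simp
next
  case x: True
  note A = assm_A1_D[OF A1]
  define \<phi> where "\<phi> z = real_of_ereal (f z)" for z
  define G where "G = gradf f x"
  define Q where "Q z = (f z + g z - (f x + g x) - ereal (v \<bullet> (z - x))) / ereal (norm (z - x))" for z
  have xU: "x \<in> U" using x A(3) by blast
  obtain \<alpha> where fx: "f x = ereal (\<phi> x)" and gx: "g x = ereal \<alpha>"
    using edom_values[OF A1 x] unfolding \<phi>_def by metis
  have D: "GDERIV \<phi> x :> G"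
    unfolding \<phi>_def G_def using gradf_GDERIV[OF A(4) xU] by simp
  have Q: "Q z = ereal ((\<phi> z + \<beta> - (\<phi> x + \<alpha>) - v \<bullet> (z - x)) / norm (z - x))"
    if "g z = ereal \<beta>" "f z = ereal (\<phi> z)" "z \<noteq> x" for z \<beta>
    unfolding Q_def using that fx gx by simp
  have reg: "v \<in> regular_subdiff (\<lambda>z. f z + g z) x \<longleftrightarrow> 0 \<le> Liminf (at x) Q"
    unfolding regular_subdiff_def Q_def using fx gx by simp
  show ?thesis
    unfolding reg G_def[symmetric]
  proof
    assume "v - G \<in> convex_subdiff g x"
    then have sub: "g x + ereal ((v - G) \<bullet> (z - x)) \<le> g z" for z
      by (simp add: convex_subdiff_def)
    show "0 \<le> Liminf (at x) Q"
      unfolding le_Liminf_iff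
    proof (intro allI impI)
      fix y :: ereal assume "y < 0"
      then obtain r where r: "y < ereal r" "ereal r < 0"
        using ereal_dense2 by blast
      then have "- r > 0" by simp
      from GDERIV_linear_approximation[OF D this]
      obtain d where d: "d > 0" "\<And>z. norm (z - x) < d \<Longrightarrow> \<bar>\<phi> z - \<phi> x - G \<bullet> (z - x)\<bar> \<le> - r * norm (z - x)"
        by blast
      have "\<forall>\<^sub>F z in at x. z \<in> U"
        using A(2) xU by (rule eventually_at_in_open')
      moreover have "\<forall>\<^sub>F z in at x. norm (z - x) < d"
        unfolding eventually_at using d(1) by (auto simp: dist_norm)
      moreover have "\<forall>\<^sub>F z in at x. z \<noteq> x"
        by (simp add: eventually_at_filter)
      ultimately show "\<forall>\<^sub>F z in at x. y < Q z"
      proof eventually_elim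
        case (elim z)
        have fz: "f z = ereal (\<phi> z)"
          using A(4) elim(1) by (simp add: twice_cont_diff_on_def \<phi>_def ereal_real')
        show ?case
        proof (cases rule: proper_value_cases[OF A(5), of z])
          case 1
          then have "Q z = \<infinity>" using fz fx gx elim(3) by (simp add: Q_def)
          then show ?thesis using \<open>y < 0\<close> by auto
        next
          case (2 \<beta>)
          have "(v - G) \<bullet> (z - x) \<le> \<beta> - \<alpha>"
            using sub[of z] gx 2 by simp
          moreover have "G \<bullet> (z - x) + r * norm (z - x) \<le> \<phi> z - \<phi> x"
            using d(2)[OF elim(2)] by linarith
          ultimately have "r * norm (z - x) \<le> \<phi> z + \<beta> - (\<phi> x + \<alpha>) - v \<bullet> (z - x)"
            by (simp add: inner_diff_left)
          then have "r \<le> (\<phi> z + \<beta> - (\<phi> x + \<alpha>) - v \<bullet> (z - x)) / norm (z - x)"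
            using elim(3) by (simp add: le_divide_eq)
          then have "ereal r \<le> Q z"
            using Q[OF 2 fz elim(3)] by simp
          then show ?thesis using r(1) by order
        qed
      qed
    qed
  next
    assume L: "0 \<le> Liminf (at x) Q"
    have "g x + ereal ((v - G) \<bullet> (z - x)) \<le> g z" for z
    proof (cases rule: proper_value_cases[OF A(5), of z])
      case (2 \<beta>)
      show ?thesis
      proof (cases "z = x")
        case False
        then have nz: "norm (z - x) > 0" by simp
        have "\<alpha> + (v - G) \<bullet> (z - x) \<le> \<beta> + e" if "e > 0" for e :: real
        proof -
          define \<epsilon> where "\<epsilon> = e / (2 * norm (z - x))"
          have \<epsilon>: "\<epsilon> > 0" using that nz by (simp add: \<epsilon>_def)
          then have "ereal (- \<epsilon>) < 0" by simp
          then have "\<forall>\<^sub>F w in at x. ereal (- \<epsilon>) < Q w"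
            using L unfolding le_Liminf_iff by blast
          then obtain d1 where d1: "d1 > 0" "\<And>w. w \<noteq> x \<Longrightarrow> norm (w - x) < d1 \<Longrightarrow> ereal (- \<epsilon>) < Q w"
            unfolding eventually_at by (auto simp: dist_norm)
          obtain d2 where d2: "d2 > 0"
            "\<And>w. norm (w - x) < d2 \<Longrightarrow> \<bar>\<phi> w - \<phi> x - G \<bullet> (w - x)\<bar> \<le> \<epsilon> * norm (w - x)"
            using GDERIV_linear_approximation[OF D \<epsilon>] by blast
          define t where "t = min (1/2) (min d1 d2 / (2 * norm (z - x)))"
          have t: "0 < t" "t < 1"
            using d1(1) d2(1) nz by (auto simp: t_def)
          define w where "w = (1 - t) *\<^sub>R x + t *\<^sub>R z"
          have wx: "w - x = t *\<^sub>R (z - x)" by (simp add: w_def algebra_simps)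
          have "t * norm (z - x) \<le> min d1 d2 / (2 * norm (z - x)) * norm (z - x)"
            unfolding t_def by (intro mult_right_mono) auto
          also have "\<dots> = min d1 d2 / 2" using nz by simp
          also have "\<dots> < min d1 d2" using d1(1) d2(1) by (simp add: min_def)
          finally have w: "norm (w - x) < d1" "norm (w - x) < d2" "w \<noteq> x"
            using t nz wx by auto
          have "g w \<le> ereal (1 - t) * g x + ereal t * g z"
            using A(7) t unfolding convex_fun_def w_def by simp
          then have gw: "g w \<le> ereal ((1 - t) * \<alpha> + t * \<beta>)"
            using gx 2 by simp
          then have "w \<in> edom g" by (auto simp: edom_def)
          then obtain \<gamma> where fw: "f w = ereal (\<phi> w)" and \<gamma>: "g w = ereal \<gamma>"
            using edom_values[OF A1] unfolding \<phi>_def by metis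
          have "- \<epsilon> < (\<phi> w + \<gamma> - (\<phi> x + \<alpha>) - v \<bullet> (w - x)) / norm (w - x)"
            using d1(2)[OF w(3,1)] Q[OF \<gamma> fw w(3)] by simp
          then have "- \<epsilon> * norm (w - x) < \<phi> w + \<gamma> - (\<phi> x + \<alpha>) - v \<bullet> (w - x)"
            using w(3) by (simp add: less_divide_eq)
          moreover have "\<phi> w - \<phi> x \<le> G \<bullet> (w - x) + \<epsilon> * norm (w - x)"
            using d2(2)[OF w(2)] by linarith
          moreover have "\<gamma> \<le> (1 - t) * \<alpha> + t * \<beta>" using gw \<gamma> by simp
          ultimately have "(v - G) \<bullet> (w - x) - 2 * (\<epsilon> * norm (w - x)) \<le> t * (\<beta> - \<alpha>)"
            by (simp add: inner_diff_left algebra_simps)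
          moreover have "2 * (\<epsilon> * norm (w - x)) = t * e"
            using t nz by (simp add: wx \<epsilon>_def)
          moreover have "(v - G) \<bullet> (w - x) = t * ((v - G) \<bullet> (z - x))"
            by (simp add: wx)
          ultimately have "t * ((v - G) \<bullet> (z - x) - e) \<le> t * (\<beta> - \<alpha>)"
            by (simp add: right_diff_distrib)
          then show ?thesis using t(1) by simp
        qed
        then have "\<alpha> + (v - G) \<bullet> (z - x) \<le> \<beta>"
          by (rule field_le_epsilon)
        then show ?thesis using gx 2 by simp
      qed (simp add: gx)
    qed simp
    then show "v - G \<in> convex_subdiff g x"
      by (simp add: convex_subdiff_def gx)
  qed
qed

text \<open>
  Passing to the limiting subdifferential adds nothing: the subgradient inequality of \<open>g\<close>
  survives the limit, because \<open>f\<close> and its gradient are continuous and hence the values of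
  \<open>g\<close> converge together with those of the sum.
\<close>

lemma stationary_iff:
  fixes f g :: "'a::euclidean_space \<Rightarrow> ereal"
  assumes A1: "assm_A1 f g U"
  shows "a \<in> stationary f g \<longleftrightarrow> - gradf f a \<in> convex_subdiff g a"
proof
  assume "- gradf f a \<in> convex_subdiff g a"
  then have reg: "0 \<in> regular_subdiff (\<lambda>z. f z + g z) a"
    by (simp add: regular_subdiff_sum_iff[OF A1])
  moreover have "\<bar>f a + g a\<bar> \<noteq> \<infinity>"
    using reg by (simp add: regular_subdiff_def)
  ultimately show "a \<in> stationary f g"
    unfolding stationary_def limiting_subdiff_def mem_Collect_eq
    by (intro conjI exI[of _ "\<lambda>_::nat. a"] exI[of _ "\<lambda>_::nat. 0::'a"]) auto
next
  note A = assm_A1_D[OF A1]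
  define \<phi> where "\<phi> z = real_of_ereal (f z)" for z
  assume "a \<in> stationary f g"
  then obtain X V where fin: "\<bar>f a + g a\<bar> \<noteq> \<infinity>" and X: "X \<longlonglongrightarrow> a"
    "(\<lambda>n. f (X n) + g (X n)) \<longlonglongrightarrow> f a + g a"
    and V: "\<And>n. V n \<in> regular_subdiff (\<lambda>z. f z + g z) (X n)" "V \<longlonglongrightarrow> 0"
    unfolding stationary_def limiting_subdiff_def mem_Collect_eq by metis
  have a: "a \<in> edom g" "a \<in> U" using fin composite_finite_iff[OF A1] A(3) by auto
  have XU: "X n \<in> edom g" for n
    using V(1)[of n] composite_finite_iff[OF A1] by (simp add: regular_subdiff_def)
  have sub: "g (X n) + ereal ((V n - gradf f (X n)) \<bullet> (z - X n)) \<le> g z" for n z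
    using V(1)[of n] unfolding regular_subdiff_sum_iff[OF A1] convex_subdiff_def by blast
  have "isCont \<phi> a"
    unfolding \<phi>_def using gradf_GDERIV[OF A(4) a(2)] by (auto simp: gderiv_def intro: has_derivative_continuous)
  then have "(\<lambda>n. \<phi> (X n)) \<longlonglongrightarrow> \<phi> a"
    using X(1) by (rule isCont_tendsto_compose)
  then have "(\<lambda>n. (f (X n) + g (X n)) - ereal (\<phi> (X n))) \<longlonglongrightarrow> (f a + g a) - ereal (\<phi> a)"
    by (intro tendsto_diff_ereal_general X(2)) auto
  moreover have cancel: "f z + g z - ereal (\<phi> z) = g z" if z: "z \<in> edom g" for z
  proof -
    obtain \<alpha> where "g z = ereal \<alpha>" and fz: "f z = ereal (\<phi> z)"
      unfolding \<phi>_def by (rule edom_values[OF A1 z])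
    then show ?thesis by (simp only: fz) simp
  qed
  ultimately have g: "(\<lambda>n. g (X n)) \<longlonglongrightarrow> g a"
    by (simp only: cancel[OF a(1)] cancel[OF XU])
  have "(\<lambda>n. gradf f (X n)) \<longlonglongrightarrow> gradf f a"
    using gradf_isCont[OF A(4) a(2)] X(1) by (rule isCont_tendsto_compose)
  then have lin: "(\<lambda>n. ereal ((V n - gradf f (X n)) \<bullet> (z - X n))) \<longlonglongrightarrow> ereal ((0 - gradf f a) \<bullet> (z - a))" for z
    using V(2) X(1) by (intro tendsto_intros)
  have "g a + ereal (- gradf f a \<bullet> (z - a)) \<le> g z" for z
  proof -
    have "(\<lambda>n. g (X n) + ereal ((V n - gradf f (X n)) \<bullet> (z - X n))) \<longlonglongrightarrow>
        g a + ereal ((0 - gradf f a) \<bullet> (z - a))"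
      by (intro tendsto_add_ereal_general g lin) auto
    then have "g a + ereal ((0 - gradf f a) \<bullet> (z - a)) \<le> g z"
      by (intro tendsto_upperbound) (use sub in auto)
    then show ?thesis by simp
  qed
  moreover have "\<bar>g a\<bar> \<noteq> \<infinity>"
    by (rule edom_values[OF A1 a(1)]) simp
  ultimately show "- gradf f a \<in> convex_subdiff g a"
    by (simp add: convex_subdiff_def)
qed

lemma stationary_iff_res_eq_0:
  fixes f g :: "'a::euclidean_space \<Rightarrow> ereal"
  assumes A1: "assm_A1 f g U"
  shows "a \<in> stationary f g \<longleftrightarrow> res f g a = 0"
proof -
  have "prox g (a - gradf f a) = a \<longleftrightarrow> - gradf f a \<in> convex_subdiff g a"
    using prox_eq_iff[OF assm_A1_D(5-7)[OF A1], of "a - gradf f a" a] by simp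
  then show ?thesis
    unfolding stationary_iff[OF A1] res_def by (metis eq_iff_diff_eq_0 norm_eq_zero)
qed

section \<open>One step of the method\<close>

text \<open>
  The factor of \<open>\<delta>\<close> is the larger root of \<open>c t\<^sup>2 = A t + B\<close>; the proof completes the square.
\<close>

lemma quadratic_inequality_bound:
  fixes d \<delta> c A B :: real
  assumes "c > 0" "A \<ge> 0" "B \<ge> 0" "\<delta> \<ge> 0" and le: "c * d\<^sup>2 \<le> A * \<delta> * d + B * \<delta>\<^sup>2"
  shows "d \<le> (A / (2 * c) + sqrt (4 * B / c + A\<^sup>2 / c\<^sup>2) / 2) * \<delta>"
proof -
  define S where "S = sqrt (4 * B / c + A\<^sup>2 / c\<^sup>2)"
  have S: "S \<ge> 0" "S\<^sup>2 = 4 * B / c + A\<^sup>2 / c\<^sup>2"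
    using assms by (auto simp: S_def)
  have "(2 * d - A / c * \<delta>)\<^sup>2 = 4 / c * (c * d\<^sup>2 - A * \<delta> * d) + A\<^sup>2 / c\<^sup>2 * \<delta>\<^sup>2"
    using assms(1) by (simp add: power2_eq_square field_simps)
  also have "\<dots> \<le> 4 / c * (B * \<delta>\<^sup>2) + A\<^sup>2 / c\<^sup>2 * \<delta>\<^sup>2"
    using le assms(1) by (intro add_right_mono mult_left_mono) auto
  also have "\<dots> = (S * \<delta>)\<^sup>2"
    by (simp add: S(2) power_mult_distrib algebra_simps)
  finally have "2 * d - A / c * \<delta> \<le> S * \<delta>"
    by (rule power2_le_imp_le) (use S assms in simp)
  then show ?thesis
    unfolding S_def[symmetric] by (simp add: algebra_simps)
qed

lemma model_R_eq:
  fixes f g :: "'a::euclidean_space \<Rightarrow> ereal"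
  assumes A1: "assm_A1 f g U" and "xk \<in> U" "1 < q"
  shows "y - model_R f g q xk L y = prox g (y - (gradf f xk + hessf f xk (y - xk) +
    (L * norm (y - xk) powr (q - 2)) *\<^sub>R (y - xk)))"
  using grad_eqI[OF reg_model_GDERIV[OF assm_A1_D(4,2)[OF A1] assms(2,3)]]
  by (simp add: model_R_def)

text \<open>
  The central estimate. Let \<open>p = y - v\<close>, a proximal point. The negative gradient of the model
  at \<open>y\<close>, corrected by \<open>v\<close>, is a subgradient of \<open>g\<close> at \<open>p\<close>, and \<open>- gradf f a\<close> is one at \<open>a\<close>, so
  their difference is monotone along \<open>p - a\<close>. Expanding both gradients around \<open>a\<close> isolates
  the curvature term \<open>(p - a) \<bullet> hessf f a (p - a)\<close>, which is nonnegative by second-order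
  stationarity: the definition quantifies over all proximal points, and \<open>p\<close> is one. No
  strong convexity is available; the coercive term that remains on the left comes from the
  regulariser alone.
\<close>

lemma step_monotonicity_estimate:
  fixes f g :: "'a::euclidean_space \<Rightarrow> ereal" and x y a :: 'a
  assumes A1: "assm_A1 f g U" and \<Gamma>: "convex \<Gamma>" "\<Gamma> \<subseteq> U"
    and Lg: "Lg-lipschitz_on \<Gamma> (gradf f)" and LH: "LH-lipschitz_on \<Gamma> (hessf f)"
    and x: "x \<in> \<Gamma>" and a: "a \<in> interior \<Gamma>" "a \<in> second_order_stationary f g"
    and q: "1 < q" and L: "0 \<le> L"
  defines "v \<equiv> model_R f g q x L y" and "d \<equiv> norm (y - x)" and "\<delta> \<equiv> norm (x - a)"
  shows "L * d powr (q - 2) * (d - 2 * \<delta> - 2 * norm v)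
    \<le> (1 + Lg) * norm v + LH * \<delta> * d + LH / 2 * \<delta>\<^sup>2"
proof -
  note A = assm_A1_D[OF A1]
  define G H Ha where "G = gradf f" and "H = hessf f x" and "Ha = hessf f a"
  define s where "s = L * d powr (q - 2)"
  define p where "p = y - v"
  define w where "w = norm (p - a)"
  define e where "e = G x - G a - Ha (x - a)"
  define N where "N = v - e - (H - Ha) (y - x) - Ha v"
  define M where "M = (1 + Lg) * norm v + LH * \<delta> * d + LH / 2 * \<delta>\<^sup>2"
  have aG: "a \<in> \<Gamma>" using a(1) interior_subset by blast
  have xU: "x \<in> U" using x \<Gamma>(2) by blast
  have s0: "s \<ge> 0" using L by (simp add: s_def)
  have nn: "0 \<le> Lg" "0 \<le> LH" using lipschitz_on_nonneg[OF Lg] lipschitz_on_nonneg[OF LH] .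
  have p: "p = prox g (y - (G x + H (y - x) + s *\<^sub>R (y - x)))"
    unfolding p_def v_def G_def H_def s_def d_def by (rule model_R_eq[OF A1 xU q])

  have "norm (Ha v) \<le> Lg * norm v"
    unfolding Ha_def using aG \<Gamma>(2)
    by (intro derivative_bound_of_lipschitz[OF _ Lg a(1)] hessf_has_derivative[OF A(4)]) auto
  moreover have "norm ((H - Ha) (y - x)) \<le> LH * \<delta> * d"
  proof -
    have "norm ((H - Ha) (y - x)) \<le> norm (H - Ha) * d"
      unfolding d_def by (rule norm_blinfun)
    also have "\<dots> \<le> LH * \<delta> * d"
      using lipschitz_onD[OF LH x aG] by (intro mult_right_mono) (auto simp: H_def Ha_def \<delta>_def d_def dist_norm)
    finally show ?thesis .
  qed
  moreover have "norm e \<le> LH / 2 * \<delta>\<^sup>2"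
    unfolding e_def G_def Ha_def \<delta>_def using \<Gamma>(2)
    by (intro gradient_taylor_bound[OF _ LH \<Gamma>(1) aG x] hessf_has_derivative[OF A(4)]) auto
  moreover have "norm N \<le> norm v + norm e + norm ((H - Ha) (y - x)) + norm (Ha v)"
    unfolding N_def by norm
  ultimately have N: "norm N \<le> M"
    by (simp add: M_def algebra_simps)
  have M0: "M \<ge> 0" using N norm_ge_zero order_trans by blast

  have "0 \<le> ((y - (G x + H (y - x) + s *\<^sub>R (y - x)) - p) - (- G a)) \<bullet> (p - a)"
  proof (rule convex_subdiff_monotone)
    show "y - (G x + H (y - x) + s *\<^sub>R (y - x)) - p \<in> convex_subdiff g p"
      unfolding p by (rule prox_subgradient[OF A(5-7)])
    show "- G a \<in> convex_subdiff g a"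
      using a(2) stationary_iff[OF A1] by (auto simp: second_order_stationary_def G_def)
  qed
  also have "(y - (G x + H (y - x) + s *\<^sub>R (y - x)) - p) - (- G a) = N - Ha (p - a) - s *\<^sub>R (y - x)"
    by (simp add: N_def e_def p_def blinfun.diff_left blinfun.diff_right blinfun.add_right algebra_simps)
  finally have "s * ((y - x) \<bullet> (p - a)) + Ha (p - a) \<bullet> (p - a) \<le> N \<bullet> (p - a)"
    by (simp add: inner_diff_left)
  moreover have "0 \<le> Ha (p - a) \<bullet> (p - a)"
    using a(2) p unfolding second_order_stationary_def Ha_def by (auto simp: inner_commute)
  ultimately have "s * ((y - x) \<bullet> (p - a)) \<le> N \<bullet> (p - a)" by simp
  also have "\<dots> \<le> M * w"
    using norm_cauchy_schwarz[of N "p - a"] mult_right_mono[OF N, of w] by (simp add: w_def)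
  finally have upper: "s * ((y - x) \<bullet> (p - a)) \<le> M * w" .
  have "w * (w - \<delta> - norm v) \<le> (y - x) \<bullet> (p - a)"
  proof -
    have "y - x = (p - a) - (x - a) + v" by (simp add: p_def)
    then have "(y - x) \<bullet> (p - a) = w * w - (x - a) \<bullet> (p - a) + v \<bullet> (p - a)"
      by (simp add: inner_add_left inner_diff_left w_def power2_norm_eq_inner flip: power2_eq_square)
    moreover have "(x - a) \<bullet> (p - a) \<le> \<delta> * w" "- (v \<bullet> (p - a)) \<le> norm v * w"
      using norm_cauchy_schwarz[of "x - a" "p - a"] norm_cauchy_schwarz[of "-v" "p - a"]
      by (auto simp: \<delta>_def w_def)
    ultimately show ?thesis by (simp add: algebra_simps)
  qed
  from mult_left_mono[OF this s0] upper
  have "w * (s * (w - \<delta> - norm v)) \<le> w * M"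
    by (simp add: mult_ac)
  moreover have "w \<ge> 0" by (simp add: w_def)
  ultimately have *: "s * (w - \<delta> - norm v) \<le> M"
  proof (cases "w = 0")
    case True
    have "s * (w - \<delta> - norm v) \<le> 0"
      using s0 True norm_ge_zero[of v] norm_ge_zero[of "x - a"]
      by (intro mult_nonneg_nonpos) (auto simp: \<delta>_def simp del: norm_ge_zero)
    then show ?thesis using M0 by simp
  qed auto
  have "d \<le> w + \<delta> + norm v"
    unfolding d_def w_def \<delta>_def p_def by norm
  then have "s * (d - 2 * \<delta> - 2 * norm v) \<le> s * (w - \<delta> - norm v)"
    using s0 by (intro mult_left_mono) auto
  with * show ?thesis
    unfolding s_def M_def by linarith
qed

text \<open>
  For a short step the terms with \<open>norm v\<close> are absorbed by the left-hand side of the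
  preceding estimate, at the price of the factor \<open>\<eta>0\<close>. The slack \<open>vsigma\<close>
  makes this possible: as \<open>2 < q\<close>, a sufficiently short step has \<open>2 * L * d powr (q - 2)\<close> below it. Since \<open>q \<le> 3\<close>, a step of length
  \<open>d \<le> 1\<close> satisfies \<open>d \<le> d powr (q - 2)\<close>; this reduces every exponent to the
  cubic case and leaves a quadratic inequality between \<open>d\<close> and the distance to \<open>a\<close>.
\<close>

lemma step_length_le_distance:
  fixes f g :: "'a::euclidean_space \<Rightarrow> ereal"
  assumes A1: "assm_A1 f g U" and \<Gamma>: "convex \<Gamma>" "\<Gamma> \<subseteq> U"
    and Lg: "Lg-lipschitz_on \<Gamma> (gradf f)" and LH: "LH-lipschitz_on \<Gamma> (hessf f)"
    and x: "x \<in> \<Gamma>" and a: "a \<in> interior \<Gamma>" "a \<in> second_order_stationary f g"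
    and q: "2 < q" "q \<le> 3" and L: "0 < Lm" "Lm \<le> L" and \<rho>: "0 \<le> \<rho>" and vsigma: "0 \<le> vsigma"
    and inexact: "norm (model_R f g q x L y) \<le> \<rho> * L * norm (y - x) powr (q - 1)"
    and short: "norm (y - x) \<le> 1" "2 * L * norm (y - x) powr (q - 2) \<le> vsigma"
    and \<eta>0: "\<eta>0 = 1 - vsigma - \<rho> * (1 + vsigma + Lg)" "0 < \<eta>0"
  shows "norm (y - x) \<le> ((2 + LH / Lm) / (2 * \<eta>0)
    + sqrt (2 * LH / (\<eta>0 * Lm) + (2 + LH / Lm)\<^sup>2 / \<eta>0\<^sup>2) / 2) * norm (x - a)"
proof -
  define v d \<delta> t where "v = norm (model_R f g q x L y)" and "d = norm (y - x)"
    and "\<delta> = norm (x - a)" and "t = d powr (q - 2)"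
  have nn: "0 \<le> Lg" "0 \<le> LH" using lipschitz_on_nonneg[OF Lg] lipschitz_on_nonneg[OF LH] .
  have d: "0 \<le> d" "d \<le> 1" and \<delta>: "0 \<le> \<delta>" and t0: "0 \<le> t" and L0: "0 < L"
    using short L by (auto simp: d_def \<delta>_def t_def)
  have td: "d powr (q - 1) = t * d"
    using powr_add[of d "q - 2" 1] d by (simp add: t_def)
  have dt: "d \<le> t"
    using powr_mono'[of "q - 2" 1 d] q d by (simp add: t_def)
  have v: "v \<le> \<rho> * L * (t * d)"
    using inexact td by (simp add: v_def d_def)
  have Lt: "2 * L * t \<le> vsigma" using short(2) by (simp add: t_def d_def)
  have "L * t * (d - 2 * \<delta> - 2 * v) \<le> (1 + Lg) * v + LH * \<delta> * d + LH / 2 * \<delta>\<^sup>2"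
    unfolding t_def d_def \<delta>_def v_def using q L0
    by (intro step_monotonicity_estimate[OF A1 \<Gamma> Lg LH x a]) auto
  moreover have "(2 * L * t + (1 + Lg)) * v \<le> (vsigma + (1 + Lg)) * (\<rho> * L * (t * d))"
    using v Lt nn vsigma by (intro mult_mono) (auto simp: v_def)
  ultimately have "L * (t * d * (1 - \<rho> * (1 + vsigma + Lg)))
      \<le> L * (2 * \<delta> * t) + LH * \<delta> * d + LH / 2 * \<delta>\<^sup>2"
    by (simp add: algebra_simps)
  moreover have "L * (t * d * \<eta>0) \<le> L * (t * d * (1 - \<rho> * (1 + vsigma + Lg)))"
    using \<eta>0 vsigma L0 t0 d by (intro mult_left_mono) auto
  moreover have "LH * \<delta> * d + LH / 2 * \<delta>\<^sup>2 = L * (LH / L * (\<delta> * d + \<delta>\<^sup>2 / 2))"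
    using L0 by (simp add: algebra_simps)
  ultimately have "L * (t * d * \<eta>0) \<le> L * (2 * \<delta> * t + LH / L * (\<delta> * d + \<delta>\<^sup>2 / 2))"
    by (simp add: algebra_simps)
  then have "t * d * \<eta>0 \<le> 2 * \<delta> * t + LH / L * (\<delta> * d + \<delta>\<^sup>2 / 2)"
    using L0 by simp
  also have "\<dots> \<le> 2 * \<delta> * t + LH / Lm * (\<delta> * d + \<delta>\<^sup>2 / 2)"
    using L nn \<delta> d by (intro add_left_mono mult_right_mono divide_left_mono) auto
  finally have *: "t * d * \<eta>0 \<le> 2 * \<delta> * t + LH / Lm * (\<delta> * d + \<delta>\<^sup>2 / 2)" .
  have "\<eta>0 * d\<^sup>2 \<le> (2 + LH / Lm) * \<delta> * d + LH / (2 * Lm) * \<delta>\<^sup>2"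
  proof (cases "d = 0")
    case True
    then show ?thesis using nn L by simp
  next
    case False
    then have tp: "0 < t" using d dt by simp
    \<comment> \<open>Since \<open>d \<le> t\<close>, multiplying by \<open>d / t \<le> 1\<close> keeps the terms that carry no factor \<open>t\<close>.\<close>
    have "(d / t) * (t * d * \<eta>0) \<le> (d / t) * (2 * \<delta> * t + LH / Lm * (\<delta> * d + \<delta>\<^sup>2 / 2))"
      using * d tp by (intro mult_left_mono) auto
    also have "\<dots> = 2 * \<delta> * d + (d / t) * (LH / Lm * (\<delta> * d + \<delta>\<^sup>2 / 2))"
      using tp by (simp add: algebra_simps)
    also have "\<dots> \<le> 2 * \<delta> * d + 1 * (LH / Lm * (\<delta> * d + \<delta>\<^sup>2 / 2))"
      using d dt tp nn \<delta> L by (intro add_left_mono mult_right_mono) auto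
    finally show ?thesis
      using tp by (simp add: power2_eq_square algebra_simps)
  qed
  then have "d \<le> ((2 + LH / Lm) / (2 * \<eta>0)
      + sqrt (4 * (LH / (2 * Lm)) / \<eta>0 + (2 + LH / Lm)\<^sup>2 / \<eta>0\<^sup>2) / 2) * \<delta>"
    using \<eta>0(2) nn L \<delta> by (intro quadratic_inequality_bound) auto
  moreover have "4 * (LH / (2 * Lm)) / \<eta>0 = 2 * LH / (\<eta>0 * Lm)"
    by simp
  ultimately show ?thesis
    by (simp only: d_def \<delta>_def)
qed

text \<open>
  The point \<open>y - v\<close> is the proximal gradient step of the model from \<open>y\<close>, and the gradient of
  the model at \<open>y\<close> differs from that of \<open>f\<close> by the regulariser and a Taylor remainder. Nonexpansiveness
  of the proximal mapping turns this into a bound for the residual, at \<open>y\<close> as well as at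
  \<open>y - v\<close>, so that it does not matter which of the two the algorithm selects.
\<close>

lemma residual_after_step:
  fixes f g :: "'a::euclidean_space \<Rightarrow> ereal"
  assumes A1: "assm_A1 f g U" and \<Gamma>: "convex \<Gamma>" "\<Gamma> \<subseteq> U"
    and Lg: "Lg-lipschitz_on \<Gamma> (gradf f)" and LH: "LH-lipschitz_on \<Gamma> (hessf f)"
    and in\<Gamma>: "x \<in> \<Gamma>" "y \<in> \<Gamma>" "y - v \<in> \<Gamma>" and v: "v = model_R f g q x L y"
    and q: "1 < q" "q \<le> 3" and L: "0 \<le> L" "L \<le> Lhat" and \<rho>: "0 \<le> \<rho>"
    and inexact: "norm v \<le> \<rho> * L * norm (y - x) powr (q - 1)" and short: "norm (y - x) \<le> 1"
    and z: "z = y \<or> z = y - v"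
  shows "res f g z \<le> ((3 + Lg) * \<rho> * Lhat + LH / 2 + Lhat) * norm (y - x) powr (q - 1)"
proof -
  note A = assm_A1_D[OF A1]
  define G H where "G = gradf f" and "H = hessf f x"
  define d s where "d = norm (y - x)" and "s = L * norm (y - x) powr (q - 2)"
  define D where "D = G x + H (y - x) + s *\<^sub>R (y - x)"
  have p: "y - v = prox g (y - D)"
    unfolding v D_def G_def H_def s_def
    using in\<Gamma>(1) \<Gamma>(2) q by (intro model_R_eq[OF A1]) auto
  have nn: "0 \<le> Lg" "0 \<le> LH" using lipschitz_on_nonneg[OF Lg] lipschitz_on_nonneg[OF LH] .
  have sd: "s * d = L * d powr (q - 1)"
    using powr_add[of d "q - 2" 1] by (simp add: s_def d_def)
  have "norm (G y - G x - H (y - x)) \<le> LH / 2 * d\<^sup>2"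
    unfolding G_def H_def d_def using \<Gamma>(2)
    by (intro gradient_taylor_bound[OF _ LH \<Gamma>(1) in\<Gamma>(1,2)] hessf_has_derivative[OF A(4)]) auto
  moreover have "norm (s *\<^sub>R (y - x)) = L * d powr (q - 1)"
    using sd L(1) by (simp add: s_def d_def)
  moreover have split: "D - G y = s *\<^sub>R (y - x) - (G y - G x - H (y - x))"
    by (simp add: D_def)
  ultimately have Dy: "norm (D - G y) \<le> L * d powr (q - 1) + LH / 2 * d\<^sup>2"
    unfolding split using norm_triangle_ineq4[of "s *\<^sub>R (y - x)" "G y - G x - H (y - x)"] by linarith
  have "norm (z - prox g (z - G z)) \<le> (1 + Lg) * norm v + norm (D - G y)"
  proof (cases "z = y")
    case True
    have "norm (prox g (y - D) - prox g (y - G y)) \<le> norm ((y - D) - (y - G y))"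
      by (rule prox_nonexpansive[OF A(5-7)])
    moreover have "(y - D) - (y - G y) = - (D - G y)" by simp
    ultimately have "norm ((y - v) - prox g (y - G y)) \<le> norm (D - G y)"
      unfolding p by (metis norm_minus_cancel)
    moreover have "norm (y - prox g (y - G y)) \<le> norm v + norm ((y - v) - prox g (y - G y))"
      by norm
    moreover have "0 \<le> Lg * norm v" using nn by simp
    ultimately show ?thesis
      unfolding True distrib_right by linarith
  next
    case False
    then have z': "z = y - v" using z by simp
    have "norm (prox g (y - D) - prox g (z - G z)) \<le> norm ((y - D) - (z - G z))"
      by (rule prox_nonexpansive[OF A(5-7)])
    moreover have "norm ((y - D) - (z - G z)) \<le> norm v + norm (D - G y) + norm (G y - G z)"
      unfolding z' by norm
    moreover have "norm (G y - G z) \<le> Lg * norm v"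
      using lipschitz_onD[OF Lg in\<Gamma>(2,3)] by (simp add: z' G_def dist_norm)
    ultimately show ?thesis
      unfolding p[symmetric] z'[symmetric] by (simp add: distrib_right)
  qed
  also have "\<dots> \<le> (1 + Lg) * (\<rho> * Lhat * d powr (q - 1)) + (Lhat * d powr (q - 1) + LH / 2 * d powr (q - 1))"
  proof (intro add_mono mult_left_mono)
    have "\<rho> * L * d powr (q - 1) \<le> \<rho> * Lhat * d powr (q - 1)"
      using L \<rho> by (intro mult_right_mono mult_left_mono) auto
    then show "norm v \<le> \<rho> * Lhat * d powr (q - 1)"
      using inexact unfolding d_def by linarith
    have "d powr 2 \<le> d powr (q - 1)"
      using q short by (intro powr_mono') (auto simp: d_def)
    then have "d\<^sup>2 \<le> d powr (q - 1)"
      by (simp add: d_def)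
    then have "LH / 2 * d\<^sup>2 \<le> LH / 2 * d powr (q - 1)"
      using nn by (intro mult_left_mono) auto
    moreover have "L * d powr (q - 1) \<le> Lhat * d powr (q - 1)"
      using L by (intro mult_right_mono) auto
    ultimately show "norm (D - G y) \<le> Lhat * d powr (q - 1) + LH / 2 * d powr (q - 1)"
      using Dy by linarith
  qed (use nn in auto)
  also have "\<dots> \<le> ((3 + Lg) * \<rho> * Lhat + LH / 2 + Lhat) * d powr (q - 1)"
  proof -
    have "0 \<le> 2 * \<rho> * Lhat * d powr (q - 1)" using \<rho> L by simp
    then show ?thesis by (simp add: algebra_simps)
  qed
  finally show ?thesis by (simp add: res_def G_def d_def)
qed

section \<open>Closedness of the set of second-order stationary points\<close>

text \<open>
  Replaces a projection onto \<open>A\<close>, which need not exist when \<open>A\<close> is not closed.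
\<close>

lemma edist_to_approach:
  assumes "edist_to z A \<le> ereal t" "0 < e"
  obtains a where "a \<in> A" "dist z a < t + e"
proof -
  have "edist_to z A < ereal (t + e)"
    using assms by (auto intro: le_less_trans)
  then show thesis
    using that unfolding edist_to_def INF_less_iff by auto
qed

lemma res_isCont:
  fixes f g :: "'a::euclidean_space \<Rightarrow> ereal"
  assumes A1: "assm_A1 f g U" and "z \<in> U"
  shows "isCont (res f g) z"
proof -
  note A = assm_A1_D[OF A1]
  have "1-lipschitz_on UNIV (prox g)"
    using prox_nonexpansive[OF A(5-7)] by (intro lipschitz_onI) (auto simp: dist_norm)
  then have "continuous_on UNIV (prox g)"
    by (rule lipschitz_on_continuous_on)
  then have "isCont (prox g) (z - gradf f z)"
    by (simp add: continuous_on_eq_continuous_at)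
  then have "isCont (\<lambda>x. prox g (x - gradf f x)) z"
    by (intro isCont_o2[of z "\<lambda>x. x - gradf f x" "prox g"] continuous_intros gradf_isCont[OF A(4) assms(2)])
  then show ?thesis
    unfolding res_def by (intro continuous_intros)
qed

text \<open>
  Stationarity is the equation \<open>res f g z = 0\<close>, and each curvature condition is a weak
  inequality between continuous functions of \<open>z\<close>.
\<close>

lemma second_order_stationary_closed_in:
  fixes f g :: "'a::euclidean_space \<Rightarrow> ereal"
  assumes A1: "assm_A1 f g U" and zU: "z \<in> U" and z: "z \<in> closure (second_order_stationary f g)"
  shows "z \<in> second_order_stationary f g"
proof -
  note A = assm_A1_D[OF A1]
  obtain X where X: "\<And>n. X n \<in> second_order_stationary f g" "X \<longlonglongrightarrow> z"
    using z unfolding closure_sequential by blast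
  have "(\<lambda>n. res f g (X n)) \<longlonglongrightarrow> res f g z"
    using res_isCont[OF A1 zU] X(2) by (rule isCont_tendsto_compose)
  moreover have "res f g (X n) = 0" for n
    using X(1)[of n] stationary_iff_res_eq_0[OF A1] by (auto simp: second_order_stationary_def)
  ultimately have "res f g z = 0"
    by (simp add: LIMSEQ_const_iff)
  moreover have "0 \<le> (prox g w - z) \<bullet> hessf f z (prox g w - z)" for w
  proof -
    have "(\<lambda>n. hessf f (X n)) \<longlonglongrightarrow> hessf f z"
      using hessf_isCont[OF A(4,2) zU] X(2) by (rule isCont_tendsto_compose)
    then have "(\<lambda>n. (prox g w - X n) \<bullet> hessf f (X n) (prox g w - X n)) \<longlonglongrightarrow>
        (prox g w - z) \<bullet> hessf f z (prox g w - z)"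
      using X(2) by (intro tendsto_intros)
    then show ?thesis
      using X(1) by (intro tendsto_lowerbound) (auto simp: second_order_stationary_def)
  qed
  ultimately show ?thesis
    using stationary_iff_res_eq_0[OF A1] by (simp add: second_order_stationary_def)
qed

section \<open>Vanishing step lengths\<close>

lemma generated_regularisation_ge:
  assumes "generated f g q Lm LM \<rho> \<sigma> \<tau> x LL yy jj" "j \<le> jj k"
  shows "Lm \<le> LL k j"
  using assms(2)
proof (induction j)
  case 0
  then show ?case using assms(1) by (simp add: generated_def)
next
  case (Suc j)
  then have "LL k (Suc j) = \<tau> * LL k j" "Lm \<le> LL k j"
    using assms(1) by (auto simp: generated_def)
  moreover have "1 < \<tau>" "0 < Lm" using assms(1) by (auto simp: generated_def)
  ultimately show ?case
    using mult_right_mono[of 1 \<tau> "LL k j"] by linarith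
qed

lemma generated_next_iterate:
  assumes "generated f g q Lm LM \<rho> \<sigma> \<tau> x LL yy jj"
  defines "y \<equiv> \<lambda>k. yy k (jj k)" and "L \<equiv> \<lambda>k. LL k (jj k)"
  shows "x (Suc k) = y k \<or> x (Suc k) = y k - model_R f g q (x k) (L k) (y k)"
    and "f (x (Suc k)) + g (x (Suc k)) \<le> f (y k) + g (y k)"
    and "norm (model_R f g q (x k) (L k) (y k)) \<le> \<rho> * L k * norm (y k - x k) powr (q - 1)"
    and "f (y k) + g (y k) \<le> f (x k) + g (x k) - ereal (\<sigma> * L k / q * norm (y k - x k) powr q)"
proof -
  have "x (Suc k) = (if f (y k) + g (y k) < f (y k - model_R f g q (x k) (L k) (y k)) +
        g (y k - model_R f g q (x k) (L k) (y k)) then y k else y k - model_R f g q (x k) (L k) (y k))"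
    using assms(1) unfolding generated_def Let_def y_def L_def by blast
  then show "x (Suc k) = y k \<or> x (Suc k) = y k - model_R f g q (x k) (L k) (y k)"
    "f (x (Suc k)) + g (x (Suc k)) \<le> f (y k) + g (y k)"
    by (auto split: if_splits)
  have "inexact_step f g q \<rho> (x k) (L k) (y k)" "sufficient_decrease f g q \<sigma> (x k) (L k) (y k)"
    using assms(1) unfolding generated_def y_def L_def by blast+
  then show "norm (model_R f g q (x k) (L k) (y k)) \<le> \<rho> * L k * norm (y k - x k) powr (q - 1)"
    "f (y k) + g (y k) \<le> f (x k) + g (x k) - ereal (\<sigma> * L k / q * norm (y k - x k) powr q)"
    by (auto simp: inexact_step_def sufficient_decrease_def)
qed

text \<open>
  Sufficient decrease bounds a fixed multiple of \<open>norm (y k - x k) powr q\<close> by the decrease of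
  the objective, and the objective values converge, being decreasing and bounded below.
\<close>

lemma step_lengths_tendsto_0:
  fixes f g :: "'a::euclidean_space \<Rightarrow> ereal"
  assumes A1: "assm_A1 f g U" and alg: "generated f g q Lm LM \<rho> \<sigma> \<tau> x LL yy jj"
  shows "(\<lambda>k. norm (yy k (jj k) - x k)) \<longlonglongrightarrow> 0"
proof -
  define F where "F z = f z + g z" for z
  define d c where "d k = norm (yy k (jj k) - x k)" and "c = \<sigma> * Lm / q" for k
  have param: "2 \<le> q" "0 < Lm" "0 < \<sigma>" "x 0 \<in> edom g"
    using alg by (auto simp: generated_def)
  then have c: "c > 0" by (simp add: c_def)
  have F_dec: "F (x (Suc k)) \<le> F (x k) - ereal (c * d k powr q)" for k
  proof -
    have "c * d k powr q \<le> \<sigma> * LL k (jj k) / q * d k powr q"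
      unfolding c_def using generated_regularisation_ge[OF alg] param
      by (intro mult_right_mono divide_right_mono mult_left_mono) auto
    then have "F (x k) - ereal (\<sigma> * LL k (jj k) / q * d k powr q) \<le> F (x k) - ereal (c * d k powr q)"
      by (intro ereal_minus_mono) auto
    then show ?thesis
      using generated_next_iterate(2,4)[OF alg, of k] unfolding F_def d_def by order
  qed
  have fin_iff: "\<bar>F z\<bar> \<noteq> \<infinity> \<longleftrightarrow> z \<in> edom g" for z
    unfolding F_def by (rule composite_finite_iff[OF A1])
  obtain m where m: "\<And>z. ereal m \<le> F z"
    using A1 unfolding assm_A1_def F_def by blast
  have fin: "\<bar>F (x k)\<bar> \<noteq> \<infinity>" for k
  proof (induction k)
    case 0
    then show ?case using fin_iff param by metis
  next
    case (Suc k)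
    then show ?case
      using F_dec[of k] m[of "x (Suc k)"] by (cases "F (x k)"; cases "F (x (Suc k))") auto
  qed
  define \<Phi> where "\<Phi> k = real_of_ereal (F (x k))" for k
  have \<Phi>: "F (x k) = ereal (\<Phi> k)" for k
    using fin[of k] by (simp add: \<Phi>_def ereal_real')
  have dec: "c * d k powr q \<le> \<Phi> k - \<Phi> (Suc k)" for k
    using F_dec[of k] by (simp add: \<Phi>)
  have "decseq \<Phi>"
  proof (rule decseq_SucI)
    fix k
    have "0 \<le> c * d k powr q" using c by simp
    then show "\<Phi> (Suc k) \<le> \<Phi> k" using dec[of k] by linarith
  qed
  moreover have "\<forall>k. m \<le> \<Phi> k" using m \<Phi> by (metis ereal_less_eq(3))
  ultimately obtain l where l: "\<Phi> \<longlonglongrightarrow> l"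
    by (rule decseq_convergent)
  have "(\<lambda>k. \<Phi> k - \<Phi> (Suc k)) \<longlonglongrightarrow> l - l"
    by (intro tendsto_diff l LIMSEQ_Suc)
  then have "(\<lambda>k. (\<Phi> k - \<Phi> (Suc k)) / c) \<longlonglongrightarrow> 0 / c"
    using c by (intro tendsto_divide) auto
  then have "(\<lambda>k. (\<Phi> k - \<Phi> (Suc k)) / c) \<longlonglongrightarrow> 0" by simp
  then have "(\<lambda>k. d k powr q) \<longlonglongrightarrow> 0"
    by (rule Lim_null_comparison[rotated])
      (use dec c in \<open>auto simp: pos_le_divide_eq mult.commute\<close>)
  then have "(\<lambda>k. (d k powr q) powr (1 / q)) \<longlonglongrightarrow> 0"
    by (rule tendsto_zero_powrI[where b = "1 / q"]) (use param in auto)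
  moreover have "(d k powr q) powr (1 / q) = d k" for k
    using param by (simp add: powr_powr d_def)
  ultimately show ?thesis by (simp add: d_def)
qed

section \<open>Trapping a sequence near an accumulation point\<close>

lemma accumulation_point_visits:
  fixes x :: "nat \<Rightarrow> 'a::metric_space"
  assumes "z \<in> accumulation_points x" "0 < e"
  obtains k where "N \<le> k" "dist (x k) z < e"
proof -
  obtain s where s: "strict_mono s" "(x \<circ> s) \<longlonglongrightarrow> z"
    using assms(1) by (auto simp: accumulation_points_def)
  obtain n0 where "\<And>n. n \<ge> n0 \<Longrightarrow> dist ((x \<circ> s) n) z < e"
    using metric_LIMSEQ_D[OF s(2) assms(2)] by blast
  then have "dist (x (s (max n0 N))) z < e" by (simp add: o_def)
  moreover have "N \<le> s (max n0 N)"
    using seq_suble[OF s(1), of "max n0 N"] by simp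
  ultimately show thesis using that by blast
qed

text \<open>
  Once an iterate near \<open>z\<close> has a small value of \<open>a\<close>, the total length of all later steps is at
  most twice the bound on the next one, by comparison with a geometric series. Hence the
  iterates never leave the ball in which the step bound is known to hold, and the
  accumulation point is the limit.
\<close>

lemma trapped_near_accumulation_point:
  fixes x :: "nat \<Rightarrow> 'a::metric_space"
  assumes acc: "z \<in> accumulation_points x" and "0 < e" "0 \<le> M"
    and a: "\<And>k. 0 \<le> a k" "a \<longlonglongrightarrow> 0"
    and step: "\<And>k. k0 \<le> k \<Longrightarrow> dist (x k) z \<le> e \<Longrightarrow>
      dist (x (Suc k)) (x k) \<le> M * a k \<and> a (Suc k) \<le> a k / 2"
  shows "x \<longlonglongrightarrow> z" and "\<forall>\<^sub>F k in sequentially. dist (x k) z \<le> 2 * M * a k"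
proof -
  have lim: "(\<lambda>k. 2 * M * a k) \<longlonglongrightarrow> 0"
    using tendsto_mult_left[OF a(2), of "2 * M"] by simp
  then have "\<forall>\<^sub>F k in sequentially. 2 * M * a k < e / 2"
    using \<open>0 < e\<close> by (intro order_tendstoD(2)) auto
  then obtain k1 where k1: "\<And>k. k1 \<le> k \<Longrightarrow> 2 * M * a k < e / 2"
    by (auto simp: eventually_sequentially)
  obtain K where K: "max k0 k1 \<le> K" "dist (x K) z < e / 2"
    using accumulation_point_visits[OF acc, of "e / 2"] \<open>0 < e\<close> by (metis half_gt_zero)
  \<comment> \<open>The potential \<open>2 * M * a k\<close> pays for each step, because \<open>a\<close> is at least halved.\<close>
  have pay: "dist (x (Suc k)) (x k) \<le> 2 * M * (a k - a (Suc k))" if "k0 \<le> k" "dist (x k) z \<le> e" for k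
  proof -
    have "M * a k \<le> M * (2 * (a k - a (Suc k)))"
      using step[OF that] \<open>0 \<le> M\<close> by (intro mult_left_mono) auto
    also have "\<dots> = 2 * M * (a k - a (Suc k))" by simp
    finally show ?thesis using step[OF that] by linarith
  qed
  have trapped: "dist (x k) z \<le> e \<and> dist (x k) (x K) \<le> 2 * M * (a K - a k)" if "K \<le> k" for k
    using that
  proof (induction k rule: dec_induct)
    case base
    then show ?case using K \<open>0 < e\<close> by simp
  next
    case (step k)
    have "dist (x (Suc k)) (x K) \<le> dist (x (Suc k)) (x k) + dist (x k) (x K)"
      by (rule dist_triangle)
    also have "\<dots> \<le> 2 * M * (a k - a (Suc k)) + 2 * M * (a K - a k)"
      using step K(1) by (intro add_mono pay) auto
    also have "\<dots> = 2 * M * (a K - a (Suc k))" by (simp add: algebra_simps)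
    finally have *: "dist (x (Suc k)) (x K) \<le> 2 * M * (a K - a (Suc k))" .
    also have "\<dots> \<le> 2 * M * a K" using a(1) \<open>0 \<le> M\<close> by (intro mult_left_mono) auto
    also have "\<dots> \<le> e / 2" using k1[of K] K(1) by simp
    finally have "dist (x (Suc k)) z \<le> e"
      using dist_triangle[of "x (Suc k)" z "x K"] K(2) by simp
    with * show ?case by simp
  qed
  have tail: "dist (x k) z \<le> 2 * M * a k" if k: "K \<le> k" for k
  proof (rule field_le_epsilon)
    fix \<epsilon> :: real assume "0 < \<epsilon>"
    then obtain m where m: "k \<le> m" "dist (x m) z < \<epsilon>"
      by (rule accumulation_point_visits[OF acc])
    have "dist (x m) (x k) \<le> 2 * M * (a k - a m)"
      using m(1)
    proof (induction m rule: dec_induct)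
      case (step m)
      have "dist (x (Suc m)) (x k) \<le> dist (x (Suc m)) (x m) + dist (x m) (x k)"
        by (rule dist_triangle)
      also have "\<dots> \<le> 2 * M * (a m - a (Suc m)) + 2 * M * (a k - a m)"
        using step k K(1) trapped[of m] by (intro add_mono pay) auto
      finally show ?case by (simp add: algebra_simps)
    qed simp
    also have "\<dots> \<le> 2 * M * a k" using a(1) \<open>0 \<le> M\<close> by (intro mult_left_mono) auto
    finally show "dist (x k) z \<le> 2 * M * a k + \<epsilon>"
      using m(2) dist_triangle[of "x k" z "x m"] by (simp add: dist_commute)
  qed
  then show ev: "\<forall>\<^sub>F k in sequentially. dist (x k) z \<le> 2 * M * a k"
    by (auto simp: eventually_sequentially)
  then have "(\<lambda>k. dist (x k) z) \<longlonglongrightarrow> 0"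
    by (intro Lim_null_comparison[OF _ lim]) simp
  then show "x \<longlonglongrightarrow> z"
    by (subst tendsto_dist_iff)
qed

section \<open>Superlinear convergence\<close>

theorem theorem4p6:
  fixes f g :: "'a::euclidean_space \<Rightarrow> ereal"
    and \<O> \<N> \<Gamma> :: "'a set"
    and q Lm LM \<rho> \<sigma> \<tau> Lhat Lg LH \<epsilon>bar \<epsilon>hat \<kappa> \<gamma> vsigma \<eta>0 \<eta> chat :: real
    and x y v :: "nat \<Rightarrow> 'a" and xbar :: 'a
    and LL :: "nat \<Rightarrow> nat \<Rightarrow> real" and yy :: "nat \<Rightarrow> nat \<Rightarrow> 'a" and jj :: "nat \<Rightarrow> nat"
    and kbar :: nat
  assumes q: "q \<in> {2<..3}"
    and A1: "assm_A1 f g \<O>"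
    and alg: "generated f g q Lm LM \<rho> \<sigma> \<tau> x LL yy jj"
    and y: "\<And>k. y k = yy k (jj k)"
    and v: "\<And>k. v k = model_R f g q (x k) (LL k (jj k)) (y k)"
    and A2: "assm_A2 f \<O> \<N> x"
    and Lhat: "0 < Lhat" "\<And>k. LL k (jj k) \<le> Lhat"
    and \<Gamma>: "compact \<Gamma>" "convex \<Gamma>" "\<Gamma> \<subseteq> \<N>"
    and \<epsilon>bar: "0 < \<epsilon>bar" "(\<Union>z\<in>accumulation_points x. cball z \<epsilon>bar) \<subseteq> \<Gamma>"
    and kbar: "\<And>k. k \<ge> kbar \<Longrightarrow> x k \<in> (\<Union>z\<in>accumulation_points x. cball z (\<epsilon>bar / 2))"
              "\<And>k. k \<ge> kbar \<Longrightarrow> y k \<in> \<Gamma>"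
              "\<And>k. k \<ge> kbar \<Longrightarrow> y k - v k \<in> \<Gamma>"
    and Lg: "0 < Lg" "Lg-lipschitz_on \<Gamma> (gradf f)"
    and LH: "0 < LH" "LH-lipschitz_on \<Gamma> (hessf f)"
    and xbar: "xbar \<in> accumulation_points x"
    and vsigma: "vsigma \<in> {0<..<1}"
    and \<rho>: "0 < \<rho>" "\<rho> < (1 - vsigma) / (1 + vsigma + Lg)"
    and error_bound: "0 < \<epsilon>hat" "0 < \<kappa>" "\<gamma> \<in> {1 / (q - 1)<..1}"
      "\<And>z. z \<in> cball xbar \<epsilon>hat \<inter> \<O> \<Longrightarrow>
         edist_to z (second_order_stationary f g) \<le> ereal (\<kappa> * res f g z powr \<gamma>)"
    and \<eta>0: "\<eta>0 = 1 - vsigma - \<rho> * (1 + vsigma + Lg)"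
    and \<eta>: "\<eta> = (2 + LH / Lm) / (2 * \<eta>0)
                 + sqrt (2 * LH / (\<eta>0 * Lm) + (2 + LH / Lm)\<^sup>2 / \<eta>0\<^sup>2) / 2"
    and chat: "chat = ((3 + Lg) * \<rho> * Lhat + LH / 2 + Lhat) * \<eta> powr (q - 1)"
  shows "(\<forall>\<^sub>F k in sequentially.
            res f g (x (Suc k)) \<le> \<kappa> powr (q - 1) * chat * res f g (x k) powr (\<gamma> * (q - 1)) \<and>
            norm (x (Suc k) - xbar) \<le>
              2 * \<eta> * \<kappa> * (1 + vsigma) * chat powr \<gamma> * norm (x k - xbar) powr (\<gamma> * (q - 1))) \<and>
         xbar \<in> second_order_stationary f g \<and>
         Q_superlinear_of_order (\<lambda>k. res f g (x k)) 0 (\<gamma> * (q - 1)) \<and>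
         Q_superlinear_of_order x xbar (\<gamma> * (q - 1))"
proof -
  define r d L where "r k = res f g (x k)" and "d k = norm (y k - x k)" and "L k = LL k (jj k)" for k
  define C where "C = (3 + Lg) * \<rho> * Lhat + LH / 2 + Lhat"
  define X where "X = second_order_stationary f g"

  have param: "0 < Lm" "\<rho> < 1" "0 < vsigma" "2 < q" "q \<le> 3"
    using alg q vsigma by (auto simp: generated_def)
  have "\<rho> * (1 + vsigma + Lg) < 1 - vsigma"
    using \<rho>(2) param Lg(1) by (simp add: pos_less_divide_eq)
  then have \<eta>0_pos: "0 < \<eta>0" by (simp add: \<eta>0)
  then have "0 < (2 + LH / Lm) / (2 * \<eta>0)"
    using LH(1) param by (intro divide_pos_pos add_pos_pos) auto
  moreover have "0 \<le> sqrt (2 * LH / (\<eta>0 * Lm) + (2 + LH / Lm)\<^sup>2 / \<eta>0\<^sup>2)"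
    using LH(1) param \<eta>0_pos by simp
  ultimately have \<eta>_pos: "0 < \<eta>" unfolding \<eta> by linarith
  have C_pos: "0 < C"
    using Lg(1) \<rho>(1) Lhat(1) LH(1) by (simp add: C_def add_pos_pos)
  have chat_eq: "chat = C * \<eta> powr (q - 1)" by (simp add: chat C_def)
  have chat_pos: "0 < chat" using C_pos \<eta>_pos by (simp add: chat_eq)
  have "1 / (q - 1) < \<gamma>" "\<gamma> \<le> 1" using error_bound(3) by auto
  then have order: "1 < \<gamma> * (q - 1)" using param by (simp add: pos_divide_less_eq)
  have "0 < 1 / (q - 1)" using param by simp
  then have \<gamma>_pos: "0 < \<gamma>" using \<open>1 / (q - 1) < \<gamma>\<close> by linarith
  have r0: "0 \<le> r k" for k by (simp add: r_def res_def)
  have d0: "0 \<le> d k" for k by (simp add: d_def)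

  have \<Gamma>\<O>: "\<Gamma> \<subseteq> \<O>" using \<Gamma>(3) A2 by (auto simp: assm_A2_def)
  have near_xbar: "ball xbar \<epsilon>bar \<subseteq> interior \<Gamma>"
  proof (rule interior_maximal)
    show "ball xbar \<epsilon>bar \<subseteq> \<Gamma>"
      using \<epsilon>bar(2) xbar ball_subset_cball by blast
  qed simp
  then have xbar_int: "xbar \<in> interior \<Gamma>" using \<epsilon>bar(1) by auto
  then have xbar_\<Gamma>: "xbar \<in> \<Gamma>" using interior_subset by blast
  have x_\<Gamma>: "x k \<in> \<Gamma>" if k: "kbar \<le> k" for k
  proof -
    obtain z where "z \<in> accumulation_points x" "dist z (x k) \<le> \<epsilon>bar / 2"
      using kbar(1)[OF k] by auto
    then show ?thesis using \<epsilon>bar by (auto intro!: subsetD[OF \<epsilon>bar(2)] bexI[of _ z])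
  qed

  have L: "Lm \<le> L k" "L k \<le> Lhat" for k
    using generated_regularisation_ge[OF alg] Lhat(2) by (auto simp: L_def)
  have v_eq: "v k = model_R f g q (x k) (L k) (y k)" for k
    by (simp add: v L_def)
  have v_bound: "norm (v k) \<le> \<rho> * L k * d k powr (q - 1)" for k
    using generated_next_iterate(3)[OF alg, of k] by (simp add: v L_def d_def y)
  have next_x: "x (Suc k) = y k \<or> x (Suc k) = y k - v k" for k
    using generated_next_iterate(1)[OF alg, of k] by (simp add: v y)
  have d_lim: "d \<longlonglongrightarrow> 0"
    using step_lengths_tendsto_0[OF A1 alg] by (simp add: d_def[abs_def] y)
  have "(\<lambda>k. d k powr (q - 2)) \<longlonglongrightarrow> 0"
    by (rule tendsto_zero_powrI[OF d_lim tendsto_const]) (use d0 param in auto)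
  from tendsto_mult_left[OF this, of "2 * Lhat"]
  have "\<forall>\<^sub>F k in sequentially. 2 * Lhat * d k powr (q - 2) < vsigma"
    using param by (intro order_tendstoD(2)) auto
  moreover have "\<forall>\<^sub>F k in sequentially. d k < 1"
    using d_lim by (intro order_tendstoD(2)) auto
  ultimately have "\<forall>\<^sub>F k in sequentially. kbar \<le> k \<and> d k \<le> 1 \<and> 2 * Lhat * d k powr (q - 2) \<le> vsigma"
    using eventually_ge_at_top[of kbar] by eventually_elim auto
  then obtain k0 where k0: "\<And>k. k0 \<le> k \<Longrightarrow> kbar \<le> k \<and> d k \<le> 1 \<and> 2 * Lhat * d k powr (q - 2) \<le> vsigma"
    by (auto simp: eventually_sequentially)
  have short: "d k \<le> 1" "2 * L k * d k powr (q - 2) \<le> vsigma" if "k0 \<le> k" for k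
  proof -
    have "2 * L k * d k powr (q - 2) \<le> 2 * Lhat * d k powr (q - 2)"
      using L(2)[of k] by (intro mult_right_mono) auto
    then show "2 * L k * d k powr (q - 2) \<le> vsigma" "d k \<le> 1"
      using k0[OF that] by auto
  qed

  have r_step: "r (Suc k) \<le> C * d k powr (q - 1)" if k: "k0 \<le> k" for k
    unfolding r_def C_def d_def
  proof (rule residual_after_step[OF A1 \<Gamma>(2) \<Gamma>\<O> Lg(2) LH(2) x_\<Gamma> kbar(2,3) v_eq])
    show "norm (v k) \<le> \<rho> * L k * norm (y k - x k) powr (q - 1)" "norm (y k - x k) \<le> 1"
      using v_bound[of k] short(1)[OF k] by (simp_all add: d_def)
    show "0 \<le> L k" "L k \<le> Lhat" using L[of k] param by auto
  qed (use k0[OF k] param \<rho>(1) next_x[of k] in auto)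
  have "(\<lambda>k. d k powr (q - 1)) \<longlonglongrightarrow> 0"
    by (rule tendsto_zero_powrI[OF d_lim tendsto_const]) (use d0 param in auto)
  from tendsto_mult_left[OF this, of C]
  have "(\<lambda>k. C * d k powr (q - 1)) \<longlonglongrightarrow> 0" by simp
  then have "(\<lambda>k. r (Suc k)) \<longlonglongrightarrow> 0"
    by (rule Lim_null_comparison[rotated])
      (use r_step r0 in \<open>auto simp: eventually_sequentially\<close>)
  then have r_lim: "r \<longlonglongrightarrow> 0"
    by (simp add: filterlim_sequentially_Suc)

  have d_le: "d k \<le> \<eta> * norm (x k - a)" if "k0 \<le> k" "a \<in> interior \<Gamma>" "a \<in> X" for k a
    unfolding \<eta> d_def
  proof (rule step_length_le_distance[OF A1 \<Gamma>(2) \<Gamma>\<O> Lg(2) LH(2) x_\<Gamma> that(2) that(3)[unfolded X_def]])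
    show "norm (model_R f g q (x k) (L k) (y k)) \<le> \<rho> * L k * norm (y k - x k) powr (q - 1)"
      using v_bound[of k] by (simp add: d_def v_eq)
    show "norm (y k - x k) \<le> 1" "2 * L k * norm (y k - x k) powr (q - 2) \<le> vsigma"
      using short[OF that(1)] by (simp_all add: d_def)
  qed (use k0[OF that(1)] param \<rho>(1) L \<eta>0 \<eta>0_pos in auto)

  have step_le: "norm (x (Suc k) - x k) \<le> (1 + vsigma) * d k" if "k0 \<le> k" for k
  proof -
    have "norm (x (Suc k) - x k) \<le> d k + norm (v k)"
      using next_x[of k]
    proof
      assume "x (Suc k) = y k - v k"
      then have "x (Suc k) - x k = (y k - x k) - v k" by simp
      then show ?thesis
        unfolding d_def by (metis norm_triangle_ineq4)
    qed (simp add: d_def)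
    moreover have "norm (v k) \<le> vsigma * d k"
    proof -
      have "d k powr (q - 1) = d k powr (q - 2) * d k"
        using powr_add[of "d k" "q - 2" 1] d0[of k] by simp
      then have "norm (v k) \<le> \<rho> * (L k * d k powr (q - 2)) * d k"
        using v_bound[of k] by (simp add: mult_ac)
      also have "\<dots> \<le> 1 * vsigma * d k"
        using short(2)[OF that] \<rho>(1) param L(1)[of k] d0[of k]
        by (intro mult_mono) auto
      finally show ?thesis by simp
    qed
    ultimately show ?thesis by (simp add: algebra_simps)
  qed

  have err: "\<exists>a\<in>X. dist z a < \<kappa> * res f g z powr \<gamma> + e"
    if "z \<in> \<Gamma>" "dist z xbar \<le> \<epsilon>hat" "0 < e" for z e
    using edist_to_approach[OF error_bound(4) \<open>0 < e\<close>, of z] that \<Gamma>\<O>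
    by (auto simp: X_def dist_commute)

  \<comment> \<open>Close to \<open>xbar\<close> the residual is so small that the points of \<open>X\<close> which realise the error
    bound lie in the ball around \<open>xbar\<close>, hence in the interior of \<open>\<Gamma>\<close>.\<close>
  have "(\<lambda>k. \<kappa> * r k powr \<gamma>) \<longlonglongrightarrow> 0"
    using tendsto_mult_left[OF tendsto_zero_powrI[OF r_lim tendsto_const _ \<gamma>_pos], of \<kappa>] r0 by simp
  then have "\<forall>\<^sub>F k in sequentially. k0 \<le> k \<and> \<kappa> * r k powr \<gamma> < \<epsilon>bar / 3"
    using \<epsilon>bar(1) by (intro eventually_conj eventually_ge_at_top order_tendstoD(2)) auto
  then obtain k1 where k1: "\<And>k. k1 \<le> k \<Longrightarrow> k0 \<le> k \<and> \<kappa> * r k powr \<gamma> < \<epsilon>bar / 3"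
    by (auto simp: eventually_sequentially)
  define e where "e = min \<epsilon>hat (\<epsilon>bar / 3)"
  have e: "0 < e" "e \<le> \<epsilon>hat" "e \<le> \<epsilon>bar / 3"
    using \<epsilon>bar(1) error_bound(1) by (auto simp: e_def)
  have d_le_res: "d k \<le> \<eta> * \<kappa> * r k powr \<gamma>" if k: "k1 \<le> k" and xk: "dist (x k) xbar \<le> e" for k
  proof (rule field_le_epsilon)
    fix e' :: real assume "0 < e'"
    define e2 where "e2 = min (e' / \<eta>) (\<epsilon>bar / 3)"
    have e2: "0 < e2" "e2 \<le> e' / \<eta>" "e2 \<le> \<epsilon>bar / 3"
      using \<open>0 < e'\<close> \<eta>_pos \<epsilon>bar(1)
      unfolding e2_def by (simp, intro min.cobounded1, intro min.cobounded2)
    have k': "k0 \<le> k" using k1[OF k] by simp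
    then obtain a where a: "a \<in> X" "dist (x k) a < \<kappa> * r k powr \<gamma> + e2"
      using err[of "x k" e2] x_\<Gamma> k0 xk e e2 by (auto simp: r_def)
    have "dist xbar a \<le> dist (x k) xbar + dist (x k) a"
      by (rule dist_triangle3)
    also have "\<dots> < \<epsilon>bar" using a(2) xk e e2 k1[OF k] by linarith
    finally have "a \<in> interior \<Gamma>" using near_xbar by auto
    then have "d k \<le> \<eta> * dist (x k) a"
      using d_le[OF k' _ a(1)] by (simp add: dist_norm)
    also have "\<dots> \<le> \<eta> * (\<kappa> * r k powr \<gamma> + e' / \<eta>)"
      using a(2) e2 \<eta>_pos by (intro mult_left_mono) auto
    also have "\<dots> = \<eta> * \<kappa> * r k powr \<gamma> + e'"
      using \<eta>_pos by (simp add: algebra_simps)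
    finally show "d k \<le> \<eta> * \<kappa> * r k powr \<gamma> + e'" .
  qed
  have r_le: "r (Suc k) \<le> \<kappa> powr (q - 1) * chat * r k powr (\<gamma> * (q - 1))"
    if k: "k1 \<le> k" and xk: "dist (x k) xbar \<le> e" for k
  proof -
    have "r (Suc k) \<le> C * d k powr (q - 1)"
      using r_step k1[OF k] by simp
    also have "\<dots> \<le> C * (\<eta> * \<kappa> * r k powr \<gamma>) powr (q - 1)"
      using d_le_res[OF k xk] d0 C_pos param by (intro mult_left_mono powr_mono2) auto
    also have "\<dots> = \<kappa> powr (q - 1) * chat * r k powr (\<gamma> * (q - 1))"
      using \<eta>_pos error_bound(2) by (simp add: chat_eq powr_mult powr_powr)
    finally show ?thesis .
  qed

  \<comment> \<open>The order \<open>\<gamma> * (q - 1)\<close> exceeds \<open>1\<close>, so one factor \<open>r k powr \<gamma>\<close> can be split off and the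
    remaining power of \<open>r k\<close> still tends to \<open>0\<close>.\<close>
  define K where "K = (\<kappa> powr (q - 1) * chat) powr \<gamma>"
  have "(\<lambda>k. r k powr (\<gamma> * (\<gamma> * (q - 1) - 1))) \<longlonglongrightarrow> 0"
    by (rule tendsto_zero_powrI[OF r_lim tendsto_const]) (use r0 \<gamma>_pos order in auto)
  from tendsto_mult_left[OF this, of K]
  have "\<forall>\<^sub>F k in sequentially. K * r k powr (\<gamma> * (\<gamma> * (q - 1) - 1)) < 1 / 2"
    by (intro order_tendstoD(2)) auto
  then obtain k2 where k2: "\<And>k. k2 \<le> k \<Longrightarrow> K * r k powr (\<gamma> * (\<gamma> * (q - 1) - 1)) < 1 / 2"
    by (auto simp: eventually_sequentially)
  have halved: "r (Suc k) powr \<gamma> \<le> r k powr \<gamma> / 2"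
    if k: "k1 \<le> k" "k2 \<le> k" and xk: "dist (x k) xbar \<le> e" for k
  proof -
    have "r (Suc k) powr \<gamma> \<le> (\<kappa> powr (q - 1) * chat * r k powr (\<gamma> * (q - 1))) powr \<gamma>"
      using r_le[OF k(1) xk] r0 \<gamma>_pos by (intro powr_mono2) auto
    also have "\<dots> = K * r k powr (\<gamma> * (q - 1) * \<gamma>)"
      using chat_pos by (simp add: K_def powr_mult powr_powr)
    also have "r k powr (\<gamma> * (q - 1) * \<gamma>) = r k powr (\<gamma> * (\<gamma> * (q - 1) - 1)) * r k powr \<gamma>"
      by (simp add: algebra_simps flip: powr_add)
    also have "K * (r k powr (\<gamma> * (\<gamma> * (q - 1) - 1)) * r k powr \<gamma>) \<le> 1 / 2 * r k powr \<gamma>"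
      using mult_right_mono[OF less_imp_le[OF k2[OF k(2)]], of "r k powr \<gamma>"] by (simp add: mult.assoc)
    finally show ?thesis by simp
  qed

  define M where "M = (1 + vsigma) * \<eta> * \<kappa>"
  have M: "0 \<le> M" using param \<eta>_pos error_bound(2) by (simp add: M_def)
  have r\<gamma>_lim: "(\<lambda>k. r k powr \<gamma>) \<longlonglongrightarrow> 0"
    by (rule tendsto_zero_powrI[OF r_lim tendsto_const]) (use r0 \<gamma>_pos in auto)
  have moves: "dist (x (Suc k)) (x k) \<le> M * r k powr \<gamma> \<and> r (Suc k) powr \<gamma> \<le> r k powr \<gamma> / 2"
    if k: "max k1 k2 \<le> k" and xk: "dist (x k) xbar \<le> e" for k
  proof
    have "dist (x (Suc k)) (x k) \<le> (1 + vsigma) * d k"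
      using step_le k1[of k] k by (simp add: dist_norm)
    also have "\<dots> \<le> (1 + vsigma) * (\<eta> * \<kappa> * r k powr \<gamma>)"
      using d_le_res k xk param by (intro mult_left_mono) auto
    finally show "dist (x (Suc k)) (x k) \<le> M * r k powr \<gamma>" by (simp add: M_def mult.assoc)
  qed (use halved k xk in auto)
  have x_lim: "x \<longlonglongrightarrow> xbar"
    by (rule trapped_near_accumulation_point(1)[OF xbar e(1) M _ r\<gamma>_lim, of "max k1 k2"])
      (simp, rule moves)
  have x_tail: "\<forall>\<^sub>F k in sequentially. dist (x k) xbar \<le> 2 * M * r k powr \<gamma>"
    by (rule trapped_near_accumulation_point(2)[OF xbar e(1) M _ r\<gamma>_lim, of "max k1 k2"])
      (simp, rule moves)

  have "r \<longlonglongrightarrow> res f g xbar"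
    unfolding r_def[abs_def] using xbar_\<Gamma> \<Gamma>\<O> x_lim by (intro isCont_tendsto_compose[OF res_isCont[OF A1]]) auto
  then have "res f g xbar = 0"
    using r_lim LIMSEQ_unique by blast
  then have "xbar \<in> closure X"
    unfolding closure_approachable using err[OF xbar_\<Gamma>] error_bound(1) by (auto simp: dist_commute)
  then have xbar_X: "xbar \<in> X"
    using second_order_stationary_closed_in[OF A1] xbar_\<Gamma> \<Gamma>\<O> by (auto simp: X_def)

  have x_near: "\<forall>\<^sub>F k in sequentially. dist (x k) xbar < e"
    using x_lim e(1) by (rule tendstoD)
  have r_rate: "\<forall>\<^sub>F k in sequentially. r (Suc k) \<le> \<kappa> powr (q - 1) * chat * r k powr (\<gamma> * (q - 1))"
    using x_near eventually_ge_at_top[of k1] by eventually_elim (use r_le in auto)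
  have "\<forall>\<^sub>F k in sequentially. dist (x (Suc k)) xbar \<le> 2 * M * r (Suc k) powr \<gamma>"
    using x_tail by (subst eventually_sequentially_Suc)
  then have x_rate: "\<forall>\<^sub>F k in sequentially. norm (x (Suc k) - xbar) \<le>
      2 * \<eta> * \<kappa> * (1 + vsigma) * chat powr \<gamma> * norm (x k - xbar) powr (\<gamma> * (q - 1))"
    using eventually_ge_at_top[of k0]
  proof eventually_elim
    case (elim k)
    have "r (Suc k) \<le> C * d k powr (q - 1)"
      using r_step elim(2) by simp
    \<comment> \<open>The error bound is avoided here: \<open>xbar\<close> itself serves as the second-order stationary
      point in the step length estimate.\<close>
    also have "\<dots> \<le> C * (\<eta> * norm (x k - xbar)) powr (q - 1)"
      using d_le[OF elim(2) xbar_int xbar_X] d0 C_pos param by (intro mult_left_mono powr_mono2) auto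
    also have "\<dots> = chat * norm (x k - xbar) powr (q - 1)"
      using \<eta>_pos by (simp add: chat_eq powr_mult)
    finally have "r (Suc k) powr \<gamma> \<le> (chat * norm (x k - xbar) powr (q - 1)) powr \<gamma>"
      using r0 \<gamma>_pos by (intro powr_mono2) auto
    also have "\<dots> = chat powr \<gamma> * norm (x k - xbar) powr (\<gamma> * (q - 1))"
      using chat_pos by (simp add: powr_mult powr_powr mult.commute)
    finally have "2 * M * r (Suc k) powr \<gamma> \<le> 2 * M * (chat powr \<gamma> * norm (x k - xbar) powr (\<gamma> * (q - 1)))"
      using M by (intro mult_left_mono) auto
    then show ?case using elim(1) by (simp add: M_def dist_norm mult_ac)
  qed

  have "Q_superlinear_of_order r 0 (\<gamma> * (q - 1))"
    unfolding Q_superlinear_of_order_def using r_lim order r_rate r0 by auto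
  moreover have "Q_superlinear_of_order x xbar (\<gamma> * (q - 1))"
    unfolding Q_superlinear_of_order_def dist_norm using x_lim order x_rate by blast
  ultimately show ?thesis
    using eventually_conj[OF r_rate x_rate] xbar_X by (simp add: r_def[abs_def] X_def)
qed

end
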